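(* Let $d,n$ be positive integers. The variety $N(d,n)$ is irreducible if and only if $\overline{R(d,n)}=N(d,n)$.
   Context: $\mathbb{F}$ is an algebraically closed field of arbitrary characteristic. $N(d,n)\subseteq M_n(\mathbb{F})^d$ is the set of all $d$-tuples of pairwise commuting nilpotent $n\times n$ matrices over $\mathbb{F}$, with the Zariski topology. A matrix is 1-regular if each of its eigenspaces is at most 1-dimensional (so a nilpotent $n\times n$ matrix is 1-regular iff its Jordan form is a single block of order $n$). $R(d,n)$ is the set of all $(A_1,\ldots,A_d)\in N(d,n)$ such that the linear span of $A_1,\ldots,A_d$ contains a 1-regular matrix. $\overline{S}$ denotes the closure of $S$ in the Zariski topology. *)

theory Defs
  imports
    "HOL-Analysis.Abstract_Topology"
    "HOL-Computational_Algebra.Polynomial"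
    "Jordan_Normal_Form.Matrix_Kernel"
    "Jordan_Normal_Form.Char_Poly"
begin

definition mat_tuples :: "nat \<Rightarrow> nat \<Rightarrow> 'a mat list set" where
  "mat_tuples d n = {As. length As = d \<and> set As \<subseteq> carrier_mat n n}"

text \<open>Polynomial functions on \<open>mat_tuples d n\<close> in the \<open>d * n * n\<close> matrix entries.\<close>

inductive_set poly_funs :: "nat \<Rightarrow> nat \<Rightarrow> ('a :: comm_ring_1 mat list \<Rightarrow> 'a) set"
  for d n :: nat where
  const: "(\<lambda>_. c) \<in> poly_funs d n"
| entry: "l < d \<Longrightarrow> i < n \<Longrightarrow> j < n \<Longrightarrow> (\<lambda>As. (As ! l) $$ (i, j)) \<in> poly_funs d n"
| add: "p \<in> poly_funs d n \<Longrightarrow> q \<in> poly_funs d n \<Longrightarrow> (\<lambda>As. p As + q As) \<in> poly_funs d n"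
| mult: "p \<in> poly_funs d n \<Longrightarrow> q \<in> poly_funs d n \<Longrightarrow> (\<lambda>As. p As * q As) \<in> poly_funs d n"

definition zero_locus :: "nat \<Rightarrow> nat \<Rightarrow> ('a :: comm_ring_1 mat list \<Rightarrow> 'a) set \<Rightarrow> 'a mat list set" where
  "zero_locus d n P = {As \<in> mat_tuples d n. \<forall>p\<in>P. p As = 0}"

definition zariski :: "nat \<Rightarrow> nat \<Rightarrow> 'a :: idom mat list topology" where
  "zariski d n = topology (\<lambda>U. \<exists>P \<subseteq> poly_funs d n. U = mat_tuples d n - zero_locus d n P)"

lemma in_zariski_open:
  "As \<in> mat_tuples d n - zero_locus d n P \<longleftrightarrow> As \<in> mat_tuples d n \<and> (\<exists>p\<in>P. p As \<noteq> 0)"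
  by (cases "As \<in> mat_tuples d n") (simp_all add: zero_locus_def)

lemma istopology_zariski:
  "istopology (\<lambda>U :: 'a :: idom mat list set.
     \<exists>P \<subseteq> poly_funs d n. U = mat_tuples d n - zero_locus d n P)"
  unfolding istopology_def
proof (intro conjI allI impI)
  fix S T :: "'a mat list set"
  assume "\<exists>P \<subseteq> poly_funs d n. S = mat_tuples d n - zero_locus d n P"
    and "\<exists>P \<subseteq> poly_funs d n. T = mat_tuples d n - zero_locus d n P"
  then obtain P Q where P: "P \<subseteq> poly_funs d n" "S = mat_tuples d n - zero_locus d n P"
    and Q: "Q \<subseteq> poly_funs d n" "T = mat_tuples d n - zero_locus d n Q" by blast
  let ?PQ = "{\<lambda>As. p As * q As | p q. p \<in> P \<and> q \<in> Q}"
  have "?PQ \<subseteq> poly_funs d n" using P(1) Q(1) by (auto intro: poly_funs.mult)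
  moreover have "S \<inter> T = mat_tuples d n - zero_locus d n ?PQ"
  proof (rule Set.set_eqI)
    fix As
    have iff: "(\<exists>r\<in>?PQ. r As \<noteq> 0) \<longleftrightarrow> (\<exists>p\<in>P. p As \<noteq> 0) \<and> (\<exists>q\<in>Q. q As \<noteq> 0)"
    proof
      assume "\<exists>r\<in>?PQ. r As \<noteq> 0"
      then obtain p q where "p \<in> P" "q \<in> Q" "p As * q As \<noteq> 0" by blast
      then show "(\<exists>p\<in>P. p As \<noteq> 0) \<and> (\<exists>q\<in>Q. q As \<noteq> 0)" by auto
    next
      assume "(\<exists>p\<in>P. p As \<noteq> 0) \<and> (\<exists>q\<in>Q. q As \<noteq> 0)"
      then obtain p q where pq: "p \<in> P" "q \<in> Q" "p As \<noteq> 0" "q As \<noteq> 0" by blast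
      show "\<exists>r\<in>?PQ. r As \<noteq> 0"
        by (rule bexI[of _ "\<lambda>As. p As * q As"]) (use pq in auto)
    qed
    have conj: "(a \<and> b) \<and> (a \<and> c) \<longleftrightarrow> a \<and> b \<and> c" for a b c by blast
    show "As \<in> S \<inter> T \<longleftrightarrow> As \<in> mat_tuples d n - zero_locus d n ?PQ"
      unfolding P(2) Q(2) Int_iff in_zariski_open iff
      by (rule conj)
  qed
  ultimately show "\<exists>P \<subseteq> poly_funs d n. S \<inter> T = mat_tuples d n - zero_locus d n P" by blast
next
  fix K :: "'a mat list set set"
  assume "\<forall>U\<in>K. \<exists>P \<subseteq> poly_funs d n. U = mat_tuples d n - zero_locus d n P"
  then obtain f where f: "\<forall>U\<in>K. f U \<subseteq> poly_funs d n \<and> U = mat_tuples d n - zero_locus d n (f U)"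
    by (rule bchoice[elim_format]) blast
  have "\<Union>(f ` K) \<subseteq> poly_funs d n" using f by blast
  moreover have "\<Union>K = mat_tuples d n - zero_locus d n (\<Union>(f ` K))"
  proof (rule Set.set_eqI)
    fix As
    have "As \<in> U \<longleftrightarrow> As \<in> mat_tuples d n \<and> (\<exists>p\<in>f U. p As \<noteq> 0)" if "U \<in> K" for U
    proof -
      have "U = mat_tuples d n - zero_locus d n (f U)" by (rule conjunct2[OF bspec[OF f that]])
      then have "As \<in> U \<longleftrightarrow> As \<in> mat_tuples d n - zero_locus d n (f U)" by (rule arg_cong)
      then show ?thesis by (simp only: in_zariski_open)
    qed
    then have "As \<in> \<Union>K \<longleftrightarrow> (\<exists>U\<in>K. As \<in> mat_tuples d n \<and> (\<exists>p\<in>f U. p As \<noteq> 0))"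
      unfolding Union_iff by (rule bex_cong[OF refl])
    then show "As \<in> \<Union>K \<longleftrightarrow> As \<in> mat_tuples d n - zero_locus d n (\<Union>(f ` K))"
      by (simp only: in_zariski_open bex_simps UN_iff bex_UN)
  qed
  ultimately show "\<exists>P \<subseteq> poly_funs d n. \<Union>K = mat_tuples d n - zero_locus d n P" by blast
qed

lemma openin_zariski:
  "openin (zariski d n) U \<longleftrightarrow> (\<exists>P \<subseteq> poly_funs d n. U = mat_tuples d n - zero_locus d n P)"
  unfolding zariski_def topology_inverse'[OF istopology_zariski] ..

lemma topspace_zariski: "topspace (zariski d n) = mat_tuples d n"
proof
  show "topspace (zariski d n) \<subseteq> mat_tuples d n"
    unfolding topspace_def openin_zariski by blast
  have "openin (zariski d n) (mat_tuples d n)"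
    unfolding openin_zariski
    by (rule exI[of _ "{\<lambda>_. 1}"]) (auto simp: zero_locus_def intro: poly_funs.const)
  then show "mat_tuples d n \<subseteq> topspace (zariski d n)" by (rule openin_subset)
qed

lemma closedin_zariski:
  "closedin (zariski d n) S \<longleftrightarrow> (\<exists>P \<subseteq> poly_funs d n. S = zero_locus d n P)"
proof
  assume "closedin (zariski d n) S"
  then have S: "S \<subseteq> mat_tuples d n"
    and "\<exists>P \<subseteq> poly_funs d n. mat_tuples d n - S = mat_tuples d n - zero_locus d n P"
    unfolding closedin_def openin_zariski topspace_zariski by simp_all
  then obtain P where P: "P \<subseteq> poly_funs d n"
    "mat_tuples d n - S = mat_tuples d n - zero_locus d n P" by (elim exE conjE)
  have "mat_tuples d n - (mat_tuples d n - zero_locus d n P) = zero_locus d n P"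
    by (rule double_diff[OF _ subset_refl]) (simp add: zero_locus_def)
  then have "S = zero_locus d n P"
    using double_diff[OF S subset_refl] P(2) by simp
  with P(1) show "\<exists>P \<subseteq> poly_funs d n. S = zero_locus d n P"
    by (intro exI[of _ P] conjI)
next
  assume "\<exists>P \<subseteq> poly_funs d n. S = zero_locus d n P"
  then obtain P where P: "P \<subseteq> poly_funs d n" "S = zero_locus d n P" by (elim exE conjE)
  then have "openin (zariski d n) (mat_tuples d n - S)"
    unfolding openin_zariski by (intro exI[of _ P] conjI) simp_all
  moreover have "S \<subseteq> mat_tuples d n"
    unfolding P(2) by (simp add: zero_locus_def)
  ultimately show "closedin (zariski d n) S"
    unfolding closedin_def topspace_zariski by (intro conjI)
qed

definition irreducible_space :: "'b topology \<Rightarrow> bool" where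
  "irreducible_space X \<longleftrightarrow> topspace X \<noteq> {} \<and>
     (\<forall>S T. closedin X S \<longrightarrow> closedin X T \<longrightarrow> S \<union> T = topspace X \<longrightarrow>
        S = topspace X \<or> T = topspace X)"

definition nilpotent_mat :: "'a :: semiring_1 mat \<Rightarrow> bool" where
  "nilpotent_mat A \<longleftrightarrow> (\<exists>k. A ^\<^sub>m k = 0\<^sub>m (dim_row A) (dim_col A))"

definition commuting_nilpotent_tuples :: "nat \<Rightarrow> nat \<Rightarrow> 'a :: field mat list set" where
  "commuting_nilpotent_tuples d n = {As \<in> mat_tuples d n.
     (\<forall>A\<in>set As. nilpotent_mat A) \<and> (\<forall>A\<in>set As. \<forall>B\<in>set As. A * B = B * A)}"

text \<open>The kernel of \<open>char_matrix A k = A - k I\<close> is the eigenspace of \<open>A\<close> for \<open>k\<close>.\<close>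

definition one_regular :: "'a :: field mat \<Rightarrow> bool" where
  "one_regular A \<longleftrightarrow> (\<forall>k. eigenvalue A k \<longrightarrow> kernel_dim (char_matrix A k) \<le> 1)"

definition one_regular_tuples :: "nat \<Rightarrow> nat \<Rightarrow> 'a :: field mat list set" where
  "one_regular_tuples d n = {As \<in> commuting_nilpotent_tuples d n.
     \<exists>B \<in> LinearCombinations.module.span class_ring (module_mat TYPE('a) n n) (set As).
       one_regular B}"

end

theory Submission
  imports Defs "Jordan_Normal_Form.Jordan_Normal_Form_Uniqueness"
begin

text \<open>A nilpotent matrix is 1-regular iff its power \<open>n - 1\<close> does not vanish, so \<open>R(d,n)\<close> is the
  nonempty set of tuples in \<open>N(d,n)\<close> for which some linear combination has nonvanishing
  power \<open>n - 1\<close>, which is open in the closed set \<open>N(d,n)\<close>; hence it is dense if \<open>N(d,n)\<close> is irreducible.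

  Conversely, matrices commuting with a single Jordan block are upper triangular Toeplitz, so \<open>R(d,n)\<close>
  is contained in the set \<open>W \<subseteq> N(d,n)\<close> of tuples that are simultaneously conjugate to strictly upper
  triangular Toeplitz matrices. Two points of \<open>W\<close> are joined by a rational curve inside \<open>W\<close>, and two
  nonzero polynomials in one variable over an infinite field have a common non-root. So \<open>W\<close>, and with it
  its closure, is irreducible, and this closure is \<open>N(d,n)\<close> as soon as \<open>R(d,n)\<close> is dense.\<close>

subsection \<open>Nilpotent matrices with a single Jordan block\<close>

lemma pow_mat_add:
  assumes "A \<in> carrier_mat n n"
  shows "A ^\<^sub>m (i + j) = A ^\<^sub>m i * A ^\<^sub>m j"
  using assms by (induction j) (auto simp: assoc_mult_mat[of _ n n _ n _ n])

lemma pow_mat_commute: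
  assumes "A \<in> carrier_mat n n" "B \<in> carrier_mat n n" "A * B = B * A"
  shows "A ^\<^sub>m k * B = B * A ^\<^sub>m k"
proof (induction k)
  case (Suc k)
  have "A ^\<^sub>m Suc k * B = A ^\<^sub>m k * (B * A)"
    using assms by (simp add: assoc_mult_mat[of _ n n _ n _ n])
  also have "\<dots> = B * A ^\<^sub>m Suc k"
    using assms Suc by (simp flip: assoc_mult_mat[of _ n n _ n _ n])
  finally show ?case .
qed (use assms in auto)

lemma pow_mat_add_vec:
  assumes "A \<in> carrier_mat n n" "v \<in> carrier_vec n"
  shows "A ^\<^sub>m (i + j) *\<^sub>v v = A ^\<^sub>m i *\<^sub>v (A ^\<^sub>m j *\<^sub>v v)"
  using assms by (simp add: pow_mat_add assoc_mult_mat_vec[of _ n n _ n])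

lemma pow_mat_mult_vec_carrier [simp]:
  "A \<in> carrier_mat n n \<Longrightarrow> v \<in> carrier_vec n \<Longrightarrow> A ^\<^sub>m k *\<^sub>v v \<in> carrier_vec n"
  by (rule mult_mat_vec_carrier) auto

lemma zero_mat_mult_vec: "v \<in> carrier_vec n \<Longrightarrow> 0\<^sub>m m n *\<^sub>v v = 0\<^sub>v m"
  by (rule eq_vecI) (auto simp: scalar_prod_def)

lemma mult_mat_zero_vec: "A \<in> carrier_mat m n \<Longrightarrow> A *\<^sub>v 0\<^sub>v n = 0\<^sub>v m"
  by (rule eq_vecI) (auto simp: scalar_prod_def)

lemma pow_mat_vec_zero_mono:
  fixes A :: "'a :: comm_ring_1 mat"
  assumes "A \<in> carrier_mat n n" "v \<in> carrier_vec n" "A ^\<^sub>m m *\<^sub>v v = 0\<^sub>v n" "m \<le> k"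
  shows "A ^\<^sub>m k *\<^sub>v v = 0\<^sub>v n"
proof -
  have "A ^\<^sub>m k *\<^sub>v v = A ^\<^sub>m (k - m) *\<^sub>v (A ^\<^sub>m m *\<^sub>v v)"
    using assms(4) pow_mat_add_vec[OF assms(1,2), of "k - m" m] by simp
  then show ?thesis using assms(1,3) by (simp add: mult_mat_zero_vec)
qed

lemma nonzero_mat_vec:
  fixes A :: "'a :: comm_ring_1 mat"
  assumes "A \<in> carrier_mat m n" "A \<noteq> 0\<^sub>m m n"
  obtains v where "v \<in> carrier_vec n" "A *\<^sub>v v \<noteq> 0\<^sub>v m"
proof -
  obtain i j where ij: "i < m" "j < n" "A $$ (i, j) \<noteq> 0"
    using assms by (metis carrier_matD eq_matI index_zero_mat)
  have "(A *\<^sub>v unit_vec n j) $ i = A $$ (i, j)"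
    using assms(1) ij by simp
  then have "A *\<^sub>v unit_vec n j \<noteq> 0\<^sub>v m"
    using ij by (metis index_zero_vec(1))
  then show thesis using that[of "unit_vec n j"] by simp
qed

section \<open>Jordan blocks and Krylov matrices\<close>

lemma mult_jordan_block_index:
  fixes A :: "'a :: comm_ring_1 mat"
  assumes "A \<in> carrier_mat m n" "i < m" "j < n"
  shows "(A * jordan_block n 0) $$ (i, j) = (if j = 0 then 0 else A $$ (i, j - 1))"
proof -
  have "(A * jordan_block n 0) $$ (i, j)
      = (\<Sum>k = 0..<n. if Suc k = j then A $$ (i, k) else 0)"
    using assms by (auto simp: scalar_prod_def intro!: sum.cong)
  also have "\<dots> = (\<Sum>k = 0..<n. if k = j - 1 then (if j = 0 then 0 else A $$ (i, j - 1)) else 0)"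
    by (rule sum.cong) auto
  also have "\<dots> = (if j = 0 then 0 else A $$ (i, j - 1))"
    using assms(3) by (subst sum.delta) auto
  finally show ?thesis .
qed

lemma jordan_block_mult_index:
  fixes A :: "'a :: comm_ring_1 mat"
  assumes "A \<in> carrier_mat n m" "i < n" "j < m"
  shows "(jordan_block n 0 * A) $$ (i, j) = (if Suc i < n then A $$ (Suc i, j) else 0)"
proof -
  have "(jordan_block n 0 * A) $$ (i, j)
      = (\<Sum>k = 0..<n. jordan_block n 0 $$ (i, k) * A $$ (k, j))"
    using assms by (simp add: scalar_prod_def)
  also have "\<dots> = (\<Sum>k = 0..<n. if k = Suc i then A $$ (k, j) else 0)"
    using assms(2) by (intro sum.cong) auto
  also have "\<dots> = (if Suc i < n then A $$ (Suc i, j) else 0)"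
    by (subst sum.delta) auto
  finally show ?thesis .
qed

text \<open>The powers decrease from left to right so that \<open>B\<close> acts as the upper Jordan block.\<close>

definition krylov_mat :: "nat \<Rightarrow> 'a :: comm_ring_1 mat \<Rightarrow> 'a vec \<Rightarrow> 'a mat" where
  "krylov_mat n B v = mat n n (\<lambda>(i, j). (B ^\<^sub>m (n - 1 - j) *\<^sub>v v) $ i)"

lemma krylov_mat_carrier [simp]: "krylov_mat n B v \<in> carrier_mat n n"
  and krylov_mat_dim [simp]: "dim_row (krylov_mat n B v) = n" "dim_col (krylov_mat n B v) = n"
  by (simp_all add: krylov_mat_def)

lemma pow_mult_krylov_index:
  assumes "B \<in> carrier_mat n n" "v \<in> carrier_vec n" "i < n" "j < n"
  shows "(B ^\<^sub>m k * krylov_mat n B v) $$ (i, j) = (B ^\<^sub>m (k + (n - 1 - j)) *\<^sub>v v) $ i"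
proof -
  have "col (krylov_mat n B v) j = B ^\<^sub>m (n - 1 - j) *\<^sub>v v"
    using assms by (intro eq_vecI) (auto simp: krylov_mat_def)
  moreover have "(B ^\<^sub>m (k + (n - 1 - j)) *\<^sub>v v) $ i = row (B ^\<^sub>m k) i \<bullet> (B ^\<^sub>m (n - 1 - j) *\<^sub>v v)"
    unfolding pow_mat_add_vec[OF assms(1,2)] using assms by (intro index_mult_mat_vec) auto
  ultimately show ?thesis
    using assms by simp
qed

lemma mult_krylov:
  assumes "B \<in> carrier_mat n n" "v \<in> carrier_vec n" "B ^\<^sub>m n *\<^sub>v v = 0\<^sub>v n"
  shows "B * krylov_mat n B v = krylov_mat n B v * jordan_block n 0"
proof (rule eq_matI)
  fix i j assume "i < dim_row (krylov_mat n B v * jordan_block n 0)"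
    "j < dim_col (krylov_mat n B v * jordan_block n 0)"
  then have ij: "i < n" "j < n" by auto
  have pow: "Suc (n - 1 - j) = n - j" using ij by simp
  have "(B ^\<^sub>m 1 * krylov_mat n B v) $$ (i, j) = (B ^\<^sub>m (n - j) *\<^sub>v v) $ i"
    using pow_mult_krylov_index[OF assms(1,2) ij, of 1] pow by (simp del: pow_mat.simps)
  then have "(B * krylov_mat n B v) $$ (i, j) = (B ^\<^sub>m (n - j) *\<^sub>v v) $ i"
    using assms(1) by simp
  \<comment> \<open>Right multiplication by the block moves column \<open>j - 1\<close>, whose
    exponent is \<open>n - j\<close>, to column \<open>j\<close>. Column \<open>0\<close> becomes
    zero, which matches the left side because \<open>B^n\<close> kills \<open>v\<close>.\<close>
  moreover have "(krylov_mat n B v * jordan_block n 0) $$ (i, j) = (B ^\<^sub>m (n - j) *\<^sub>v v) $ i"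
    using ij assms(3) mult_jordan_block_index[OF krylov_mat_carrier ij, of B v]
    by (auto simp: krylov_mat_def)
  ultimately show "(B * krylov_mat n B v) $$ (i, j) = (krylov_mat n B v * jordan_block n 0) $$ (i, j)"
    by simp
qed (use assms in auto)

text \<open>Let \<open>c\<close> be a nonzero vector killed by the Krylov matrix and
  \<open>m\<close> the largest index with \<open>c $ m \<noteq> 0\<close>. Applying
  \<open>B^m\<close> raises the exponents of the columns below \<open>m\<close> to at least
  \<open>n\<close>, so these columns vanish, and only \<open>c $ m\<close> times
  \<open>B^(n-1) v\<close> survives, which is not zero.\<close>

lemma det_krylov_nonzero:
  fixes B :: "'a :: field mat"
  assumes B: "B \<in> carrier_mat n n" and v: "v \<in> carrier_vec n"
    and zero: "B ^\<^sub>m n *\<^sub>v v = 0\<^sub>v n" and nonzero: "B ^\<^sub>m (n - 1) *\<^sub>v v \<noteq> 0\<^sub>v n"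
  shows "det (krylov_mat n B v) \<noteq> 0"
proof
  let ?P = "krylov_mat n B v"
  assume "det ?P = 0"
  then obtain c where c: "c \<in> carrier_vec n" "c \<noteq> 0\<^sub>v n" "?P *\<^sub>v c = 0\<^sub>v n"
    unfolding det_0_iff_vec_prod_zero[OF krylov_mat_carrier] by blast
  let ?I = "{j. j < n \<and> c $ j \<noteq> 0}"
  define m where "m = Max ?I"
  have fin: "finite ?I" by simp
  have ne: "?I \<noteq> {}"
  proof
    assume "?I = {}"
    then have "c = 0\<^sub>v n" using c(1) by (intro eq_vecI) auto
    with c(2) show False ..
  qed
  have m: "m < n" "c $ m \<noteq> 0" using Max_in[OF fin ne] by (auto simp: m_def)
  have above: "c $ j = 0" if "m < j" "j < n" for j
    using that Max_ge[OF fin, of j] unfolding m_def by (metis (mono_tags, lifting) mem_Collect_eq not_le)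
  obtain i where i: "i < n" "(B ^\<^sub>m (n - 1) *\<^sub>v v) $ i \<noteq> 0"
    using nonzero B v by (metis carrier_vecD eq_vecI index_zero_vec mult_mat_vec_carrier pow_carrier_mat)
  have low: "(B ^\<^sub>m (m + (n - 1 - j)) *\<^sub>v v) $ i = 0" if "j < m" for j
    using pow_mat_vec_zero_mono[OF B v zero, of "m + (n - 1 - j)"] that m(1) i(1) by simp
  have "(B ^\<^sub>m m * ?P) *\<^sub>v c = B ^\<^sub>m m *\<^sub>v (?P *\<^sub>v c)"
    using B c(1) by (intro assoc_mult_mat_vec) auto
  then have "((B ^\<^sub>m m * ?P) *\<^sub>v c) $ i = 0"
    using B c i(1) by (simp add: mult_mat_zero_vec)
  moreover have "((B ^\<^sub>m m * ?P) *\<^sub>v c) $ i = (\<Sum>j = 0..<n. (B ^\<^sub>m m * ?P) $$ (i, j) * c $ j)"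
    using B c i(1) by (simp add: scalar_prod_def)
  moreover have "\<dots> = (\<Sum>j = 0..<n. (B ^\<^sub>m (m + (n - 1 - j)) *\<^sub>v v) $ i * c $ j)"
    using pow_mult_krylov_index[OF B v i(1)] by (intro sum.cong) auto
  moreover have "\<dots> = (\<Sum>j = 0..<n. if j = m then (B ^\<^sub>m (n - 1) *\<^sub>v v) $ i * c $ m else 0)"
  proof (rule sum.cong)
    fix j assume j: "j \<in> {0..<n}"
    show "(B ^\<^sub>m (m + (n - 1 - j)) *\<^sub>v v) $ i * c $ j
        = (if j = m then (B ^\<^sub>m (n - 1) *\<^sub>v v) $ i * c $ m else 0)"
      using low[of j] above[of j] j m(1) by (cases j m rule: linorder_cases) auto
  qed simp
  ultimately show False using i(2) m by simp
qed

text \<open>If the nilpotency index \<open>m\<close> exceeded \<open>n\<close>, a Jordan chain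
  longer than the dimension would exist. Its last \<open>n\<close> vectors form an invertible Krylov
  matrix with the factor \<open>B^(m-n)\<close>, so that power would be invertible although it kills
  a nonzero vector.\<close>

lemma nilpotent_pow_dim:
  fixes B :: "'a :: field mat"
  assumes B: "B \<in> carrier_mat n n" and nil: "nilpotent_mat B"
  shows "B ^\<^sub>m n = 0\<^sub>m n n"
proof -
  define m where "m = (LEAST k. B ^\<^sub>m k = 0\<^sub>m n n)"
  have "\<exists>k. B ^\<^sub>m k = 0\<^sub>m n n" using nil B by (auto simp: nilpotent_mat_def)
  then have m0: "B ^\<^sub>m m = 0\<^sub>m n n" unfolding m_def by (rule LeastI_ex)
  have mono: "B ^\<^sub>m k = 0\<^sub>m n n" if "m \<le> k" for k
    using pow_mat_add[OF B, of "k - m" m] that m0 B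
    by (metis le_add_diff_inverse2 pow_carrier_mat right_mult_zero_mat)
  have "m \<le> n"
  proof (rule ccontr)
    assume "\<not> m \<le> n"
    then have mn: "n < m" by simp
    then have "B ^\<^sub>m (m - 1) \<noteq> 0\<^sub>m n n"
      unfolding m_def by (intro not_less_Least) simp
    then obtain v where v: "v \<in> carrier_vec n" "B ^\<^sub>m (m - 1) *\<^sub>v v \<noteq> 0\<^sub>v n"
      using nonzero_mat_vec[OF pow_carrier_mat[OF B]] by blast
    \<comment> \<open>The shift by \<open>m - n\<close> makes \<open>B^n w = B^m v = 0\<close> and
      \<open>B^(n-1) w = B^(m-1) v\<close>, which is nonzero, as \<open>det_krylov_nonzero\<close>
      requires.\<close>
    define w where "w = B ^\<^sub>m (m - n) *\<^sub>v v"
    have w: "w \<in> carrier_vec n" using B v(1) by (simp add: w_def)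
    have n0: "n > 0" using v B by (cases n) auto
    have "B ^\<^sub>m n *\<^sub>v w = B ^\<^sub>m m *\<^sub>v v" "B ^\<^sub>m (n - 1) *\<^sub>v w = B ^\<^sub>m (m - 1) *\<^sub>v v"
      unfolding w_def pow_mat_add_vec[OF B v(1), symmetric] using mn n0 by simp_all
    then have P: "det (krylov_mat n B w) \<noteq> 0"
      using det_krylov_nonzero[OF B w] v m0 by (simp add: zero_mat_mult_vec)
    have "krylov_mat n B w = B ^\<^sub>m (m - n) * krylov_mat n B v"
    proof (rule eq_matI)
      fix i j assume "i < dim_row (B ^\<^sub>m (m - n) * krylov_mat n B v)"
        "j < dim_col (B ^\<^sub>m (m - n) * krylov_mat n B v)"
      then have ij: "i < n" "j < n" using B by auto
      have eq: "B ^\<^sub>m (n - 1 - j) *\<^sub>v w = B ^\<^sub>m (m - n + (n - 1 - j)) *\<^sub>v v"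
        unfolding w_def pow_mat_add_vec[OF B v(1), symmetric] by (simp add: add.commute)
      show "krylov_mat n B w $$ (i, j) = (B ^\<^sub>m (m - n) * krylov_mat n B v) $$ (i, j)"
        unfolding pow_mult_krylov_index[OF B v(1) ij] using ij eq by (simp add: krylov_mat_def)
    qed (use B in auto)
    then have "det (B ^\<^sub>m (m - n)) \<noteq> 0"
      using P B by (auto simp: det_mult[of _ n])
    \<comment> \<open>The total exponent \<open>m - n + (m - 1)\<close> is at least \<open>m\<close>
      because \<open>n < m\<close>.\<close>
    moreover have "B ^\<^sub>m (m - n) *\<^sub>v (B ^\<^sub>m (m - 1) *\<^sub>v v) = 0\<^sub>v n"
      unfolding pow_mat_add_vec[OF B v(1), symmetric]
      using mn mono[of "m - n + (m - 1)"] v(1) by (simp add: zero_mat_mult_vec)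
    moreover have "B ^\<^sub>m (m - 1) *\<^sub>v v \<in> carrier_vec n" using B v(1) by simp
    ultimately show False
      using v(2) det_0_iff_vec_prod_zero[OF pow_carrier_mat[OF B, of "m - n"]] by blast
  qed
  then show ?thesis by (rule mono)
qed

section \<open>1-regularity as nonvanishing of the power \<open>n - 1\<close>\<close>

lemma det_nonzero_obtain_inverse:
  fixes P :: "'a :: field mat"
  assumes "P \<in> carrier_mat n n" "det P \<noteq> 0"
  obtains Q where "Q \<in> carrier_mat n n" "P * Q = 1\<^sub>m n" "Q * P = 1\<^sub>m n"
  using det_non_zero_imp_unit[OF assms, of "()"] by (auto simp: Units_def ring_mat_def)

text \<open>Any vector that survives \<open>B^(n-1)\<close> generates a Jordan chain of full length,
  and its Krylov matrix is the change of basis.\<close>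

lemma nilpotent_max_rank_jordan:
  fixes B :: "'a :: field mat"
  assumes B: "B \<in> carrier_mat n n" and nil: "nilpotent_mat B" and top: "B ^\<^sub>m (n - 1) \<noteq> 0\<^sub>m n n"
  obtains P where "P \<in> carrier_mat n n" "det P \<noteq> 0" "B * P = P * jordan_block n 0"
proof -
  obtain v where v: "v \<in> carrier_vec n" "B ^\<^sub>m (n - 1) *\<^sub>v v \<noteq> 0\<^sub>v n"
    using nonzero_mat_vec[OF pow_carrier_mat[OF B] top] by blast
  have "B ^\<^sub>m n *\<^sub>v v = 0\<^sub>v n"
    using nilpotent_pow_dim[OF B nil] v(1) by (simp add: zero_mat_mult_vec)
  then show thesis
    using that[OF krylov_mat_carrier] mult_krylov[OF B v(1)] det_krylov_nonzero[OF B v(1) _ v(2)]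
    by blast
qed

text \<open>Eigenspace dimensions are invariant under similarity, so it suffices to look at a single
  Jordan block: its kernel is a line if the diagonal entry is zero, and trivial otherwise.\<close>

lemma max_rank_imp_one_regular:
  fixes B :: "'a :: field mat"
  assumes B: "B \<in> carrier_mat n n" and nil: "nilpotent_mat B" and top: "B ^\<^sub>m (n - 1) \<noteq> 0\<^sub>m n n"
  shows "one_regular B"
proof -
  let ?J = "jordan_block n (0 :: 'a)"
  obtain P where P: "P \<in> carrier_mat n n" "det P \<noteq> 0" "B * P = P * ?J"
    using nilpotent_max_rank_jordan[OF assms] by blast
  obtain Q where Q: "Q \<in> carrier_mat n n" "P * Q = 1\<^sub>m n" "Q * P = 1\<^sub>m n"
    using det_nonzero_obtain_inverse[OF P(1,2)] by blast
  have "B = B * (P * Q)" using B Q by simp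
  also have "\<dots> = P * ?J * Q"
    using B P Q(1) by (simp flip: assoc_mult_mat[of _ n n _ n _ n])
  finally have "similar_mat_wit B ?J P Q"
    using similar_mat_witI[OF Q(2,3) _ B _ P(1) Q(1)] by simp
  then have sim: "similar_mat B ?J" unfolding similar_mat_def by blast
  have "kernel_dim (char_matrix B k) \<le> 1" for k
  proof -
    have "char_matrix B k \<in> carrier_mat n n" using B by simp
    then have "kernel_dim (char_matrix B k) = dim_gen_eigenspace B k 1"
      by (simp add: dim_gen_eigenspace_def)
    also have "\<dots> = kernel.dim n (jordan_block n (- k) ^\<^sub>m 1)"
      unfolding dim_gen_eigenspace_similar[OF sim]
      by (simp add: dim_gen_eigenspace_def kernel_dim_def char_matrix_jordan_block)
    also have "\<dots> \<le> 1"
      using dim_kernel_zero_jordan_block_pow[of n 1, where ?'a = 'a]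
        dim_kernel_non_zero_jordan_block_pow[of "- k" n 1]
      by (cases "k = 0") auto
    finally show ?thesis .
  qed
  then show ?thesis by (simp add: one_regular_def)
qed

text \<open>A basis of the kernel has at most one element. The vector \<open>u\<close> is allowed to
  be zero, which covers a trivial kernel without a separate case.\<close>

lemma kernel_dim_le_1_line:
  fixes A :: "'a :: field mat"
  assumes A: "A \<in> carrier_mat n n" and dim: "kernel_dim A \<le> 1"
  obtains u where "u \<in> carrier_vec n"
    "\<And>x. x \<in> carrier_vec n \<Longrightarrow> A *\<^sub>v x = 0\<^sub>v n \<Longrightarrow> \<exists>c. x = c \<cdot>\<^sub>v u"
proof -
  interpret K: kernel n n A by unfold_locales (rule A)
  obtain S where S: "finite S" "K.basis S" using kernel_basis_exists[OF A] by blast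
  have SK: "S \<subseteq> mat_kernel A" and gen: "K.span S = mat_kernel A"
    using S(2) by (auto simp: K.Ker.basis_def)
  have "card S \<le> 1" using K.Ker.dim_basis[OF S] dim by simp
  then obtain u where u: "u \<in> carrier_vec n" "S \<subseteq> {u}"
  proof (cases "S = {}")
    case True
    then show thesis using that[of "0\<^sub>v n"] by simp
  next
    case False
    then have "card S = 1" using \<open>card S \<le> 1\<close> S(1) by (simp add: le_Suc_eq)
    then obtain u where "S = {u}" by (auto simp: card_1_singleton_iff)
    then show thesis using that[of u] SK mat_kernel_carrier[OF A] by auto
  qed
  have "\<exists>c. x = c \<cdot>\<^sub>v u" if x: "x \<in> carrier_vec n" "A *\<^sub>v x = 0\<^sub>v n" for x
  proof -
    have "x \<in> K.NC.span S"
      using mat_kernelI[OF A x] gen K.span_same[OF SK] by simp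
    then obtain a U where U: "U \<subseteq> S" "x = K.NC.lincomb a U"
      unfolding K.NC.span_def by auto
    have "U \<subseteq> carrier_vec n" using U(1) u by auto
    then have idx: "x $ i = (\<Sum>y\<in>U. a y * y $ i)" if "i < n" for i
      unfolding U(2) using that K.NC.lincomb_index by auto
    have "U = {} \<or> U = {u}" using U(1) u(2) by auto
    then have "x = (if U = {} then 0 else a u) \<cdot>\<^sub>v u"
      using idx x(1) u(1) by (intro eq_vecI) auto
    then show ?thesis by blast
  qed
  then show thesis using that u(1) by blast
qed

text \<open>If the kernel of \<open>B\<close> is a line, then the kernel of \<open>B\<^sup>k\<close> is spanned by \<open>k\<close> vectors, here the
  first \<open>k\<close> columns of \<open>M\<close>: applying \<open>B\<^sup>k\<close> to the kernel of \<open>B\<^bsup>k+1\<^esup>\<close> lands in that line.\<close>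

lemma pow_kernel_in_range:
  fixes B :: "'a :: field mat"
  assumes B: "B \<in> carrier_mat n n" and u: "u \<in> carrier_vec n"
    and line: "\<And>x. x \<in> carrier_vec n \<Longrightarrow> B *\<^sub>v x = 0\<^sub>v n \<Longrightarrow> \<exists>c. x = c \<cdot>\<^sub>v u"
    and "k \<le> n"
  shows "\<exists>M \<in> carrier_mat n n. (\<forall>i<n. \<forall>j<n. k \<le> j \<longrightarrow> M $$ (i, j) = 0) \<and>
    (\<forall>x \<in> carrier_vec n. B ^\<^sub>m k *\<^sub>v x = 0\<^sub>v n \<longrightarrow> (\<exists>c \<in> carrier_vec n. x = M *\<^sub>v c))"
  using \<open>k \<le> n\<close>
proof (induction k)
  case 0
  show ?case
    using B by (intro bexI[of _ "0\<^sub>m n n"])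
      (auto intro!: bexI[of _ "0\<^sub>v n"] exI[of _ "0\<^sub>v n"] simp: zero_mat_mult_vec)
next
  case (Suc k)
  then have kn: "k < n" by simp
  obtain M where M: "M \<in> carrier_mat n n" "\<And>i j. i < n \<Longrightarrow> j < n \<Longrightarrow> k \<le> j \<Longrightarrow> M $$ (i, j) = 0"
    and ker: "\<And>x. x \<in> carrier_vec n \<Longrightarrow> B ^\<^sub>m k *\<^sub>v x = 0\<^sub>v n \<Longrightarrow> \<exists>c \<in> carrier_vec n. x = M *\<^sub>v c"
    using Suc by auto
  have mult: "\<exists>c. B ^\<^sub>m k *\<^sub>v x = c \<cdot>\<^sub>v u" if "x \<in> carrier_vec n" "B ^\<^sub>m Suc k *\<^sub>v x = 0\<^sub>v n" for x
    using line[of "B ^\<^sub>m k *\<^sub>v x"] pow_mat_add_vec[OF B that(1), of 1 k] that B by simp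
  show ?case
  proof (cases "\<exists>y \<in> carrier_vec n. B ^\<^sub>m k *\<^sub>v y = u")
    case True
    then obtain y where y: "y \<in> carrier_vec n" "B ^\<^sub>m k *\<^sub>v y = u" by blast
    \<comment> \<open>A preimage \<open>y\<close> of \<open>u\<close> under \<open>B^k\<close>
      becomes the new column \<open>k\<close>. If \<open>B^k x = a u\<close>, then
      \<open>x - a y\<close> lies in the kernel of \<open>B^k\<close>, which the earlier columns
      already span.\<close>
    define M' where "M' = mat n n (\<lambda>(i, j). if j = k then y $ i else M $$ (i, j))"
    have "\<exists>c \<in> carrier_vec n. x = M' *\<^sub>v c"
      if x: "x \<in> carrier_vec n" "B ^\<^sub>m Suc k *\<^sub>v x = 0\<^sub>v n" for x
    proof -
      obtain a where a: "B ^\<^sub>m k *\<^sub>v x = a \<cdot>\<^sub>v u" using mult[OF x] by blast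
      have "B ^\<^sub>m k *\<^sub>v (x - a \<cdot>\<^sub>v y) = 0\<^sub>v n"
        using B x(1) y a u by (simp add: mult_minus_distrib_mat_vec[of _ n n] mult_mat_vec[of _ n n])
      then obtain c where c: "c \<in> carrier_vec n" "x - a \<cdot>\<^sub>v y = M *\<^sub>v c"
        using ker[of "x - a \<cdot>\<^sub>v y"] x(1) y(1) by auto
      define c' where "c' = vec n (\<lambda>j. if j = k then a else c $ j)"
      have "x = M' *\<^sub>v c'"
      proof (rule eq_vecI)
        fix i assume "i < dim_vec (M' *\<^sub>v c')"
        then have i: "i < n" by (simp add: M'_def)
        have "x $ i - a * y $ i = (x - a \<cdot>\<^sub>v y) $ i" using x(1) y(1) i by simp
        also have "\<dots> = (\<Sum>j = 0..<n. M $$ (i, j) * c $ j)"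
          unfolding c(2) using M(1) c(1) i by (simp add: scalar_prod_def)
        finally have "x $ i = (\<Sum>j = 0..<n. M $$ (i, j) * c $ j) + a * y $ i"
          by (simp add: algebra_simps)
        also have "a * y $ i = (\<Sum>j = 0..<n. if j = k then a * y $ i else 0)"
          using kn by simp
        also have "(\<Sum>j = 0..<n. M $$ (i, j) * c $ j) + \<dots> = (\<Sum>j = 0..<n. M' $$ (i, j) * c' $ j)"
          unfolding sum.distrib[symmetric]
          using M(2)[OF i, of k] kn i by (intro sum.cong) (auto simp: M'_def c'_def)
        also have "\<dots> = (M' *\<^sub>v c') $ i"
          using i by (simp add: M'_def c'_def scalar_prod_def)
        finally show "x $ i = (M' *\<^sub>v c') $ i" .
      qed (use x(1) in \<open>simp add: M'_def\<close>)
      then show ?thesis by (intro bexI[of _ c']) (auto simp: c'_def)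
    qed
    moreover have "M' \<in> carrier_mat n n" "\<forall>i<n. \<forall>j<n. Suc k \<le> j \<longrightarrow> M' $$ (i, j) = 0"
      using M(2) by (auto simp: M'_def)
    ultimately show ?thesis by blast
  next
    case False
    have "\<exists>c \<in> carrier_vec n. x = M *\<^sub>v c"
      if x: "x \<in> carrier_vec n" "B ^\<^sub>m Suc k *\<^sub>v x = 0\<^sub>v n" for x
    proof -
      obtain a where a: "B ^\<^sub>m k *\<^sub>v x = a \<cdot>\<^sub>v u" using mult[OF x] by blast
      \<comment> \<open>A nonzero \<open>a\<close> would make \<open>x\<close> divided by
        \<open>a\<close> a preimage of \<open>u\<close>. Without such a preimage the kernel does not
        grow from \<open>k\<close> to \<open>k + 1\<close>, and the old \<open>M\<close> still
        serves.\<close>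
      have "a = 0"
      proof (rule ccontr)
        assume "a \<noteq> 0"
        then have "B ^\<^sub>m k *\<^sub>v (inverse a \<cdot>\<^sub>v x) = u"
          using B x(1) a u by (simp add: mult_mat_vec[of _ n n] smult_smult_assoc)
        then show False using False x(1) by (metis smult_carrier_vec)
      qed
      then have "B ^\<^sub>m k *\<^sub>v x = 0\<^sub>v n" using a u by auto
      then show ?thesis using ker x(1) by blast
    qed
    moreover have "\<forall>i<n. \<forall>j<n. Suc k \<le> j \<longrightarrow> M $$ (i, j) = 0" using M(2) by auto
    ultimately show ?thesis using M(1) by blast
  qed
qed

text \<open>Every nonzero value of the last nonvanishing power of \<open>B\<close> is an
  eigenvector. This is needed because \<open>one_regular\<close> bounds the kernel dimension only at
  actual eigenvalues.\<close>

lemma nilpotent_eigenvalue_zero: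
  fixes B :: "'a :: field mat"
  assumes B: "B \<in> carrier_mat n n" and nil: "nilpotent_mat B" and n: "n > 0"
  shows "eigenvalue B 0"
proof -
  define m where "m = (LEAST k. B ^\<^sub>m k = 0\<^sub>m n n)"
  have "B ^\<^sub>m n = 0\<^sub>m n n" by (rule nilpotent_pow_dim[OF B nil])
  then have m0: "B ^\<^sub>m m = 0\<^sub>m n n" unfolding m_def by (rule LeastI)
  have "(1\<^sub>m n :: 'a mat) $$ (0, 0) \<noteq> 0\<^sub>m n n $$ (0, 0)" using n by simp
  then have "m \<noteq> 0" using m0 B by (metis carrier_matD(1) pow_mat.simps(1))
  then have "B ^\<^sub>m (m - 1) \<noteq> 0\<^sub>m n n" unfolding m_def by (intro not_less_Least) simp
  then obtain v where v: "v \<in> carrier_vec n" "B ^\<^sub>m (m - 1) *\<^sub>v v \<noteq> 0\<^sub>v n"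
    using nonzero_mat_vec[OF pow_carrier_mat[OF B]] by blast
  have "B *\<^sub>v (B ^\<^sub>m (m - 1) *\<^sub>v v) = 0\<^sub>v n"
    using pow_mat_add_vec[OF B v(1), of 1 "m - 1"] \<open>m \<noteq> 0\<close> m0 B v(1)
    by (simp add: zero_mat_mult_vec)
  moreover have "B ^\<^sub>m (m - 1) *\<^sub>v v \<in> carrier_vec n" using B v(1) by simp
  ultimately have "eigenvector B (B ^\<^sub>m (m - 1) *\<^sub>v v) 0"
    using B v by (auto simp: eigenvector_def)
  then show ?thesis unfolding eigenvalue_def by blast
qed

text \<open>If \<open>B^(n-1)\<close> were zero, its kernel would be the whole space and hence lie
  in the range of a matrix \<open>M\<close> whose last column is zero. Such an \<open>M\<close> is
  singular, yet surjectivity gives it a right inverse.\<close>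

lemma one_regular_imp_max_rank:
  fixes B :: "'a :: field mat"
  assumes B: "B \<in> carrier_mat n n" and nil: "nilpotent_mat B" and n: "n > 0"
    and reg: "one_regular B"
  shows "B ^\<^sub>m (n - 1) \<noteq> 0\<^sub>m n n"
proof
  assume zero: "B ^\<^sub>m (n - 1) = 0\<^sub>m n n"
  have "char_matrix B 0 = B" using B by (intro eq_matI) (auto simp: char_matrix_def)
  then have "kernel_dim B \<le> 1"
    using reg nilpotent_eigenvalue_zero[OF B nil n] unfolding one_regular_def by metis
  then obtain u where "u \<in> carrier_vec n"
    "\<And>x. x \<in> carrier_vec n \<Longrightarrow> B *\<^sub>v x = 0\<^sub>v n \<Longrightarrow> \<exists>c. x = c \<cdot>\<^sub>v u"
    using kernel_dim_le_1_line[OF B] by blast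
  then obtain M where M: "M \<in> carrier_mat n n" "\<forall>i<n. \<forall>j<n. n - 1 \<le> j \<longrightarrow> M $$ (i, j) = 0"
    and ker: "\<forall>x \<in> carrier_vec n. B ^\<^sub>m (n - 1) *\<^sub>v x = 0\<^sub>v n \<longrightarrow> (\<exists>c \<in> carrier_vec n. x = M *\<^sub>v c)"
    using pow_kernel_in_range[OF B, of u "n - 1"] by auto
  have "\<exists>c. c \<in> carrier_vec n \<and> unit_vec n j = M *\<^sub>v c" for j
    using ker[rule_format, of "unit_vec n j"] zero by (auto simp: zero_mat_mult_vec)
  then have "\<exists>f. \<forall>j. f j \<in> carrier_vec n \<and> unit_vec n j = M *\<^sub>v f j"
    by (intro choice allI)
  then obtain f where f: "\<And>j. f j \<in> carrier_vec n" "\<And>j. unit_vec n j = M *\<^sub>v f j" by blast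
  \<comment> \<open>The columns of \<open>N\<close> are the chosen preimages of the unit vectors, so
    \<open>N\<close> is a right inverse of \<open>M\<close>.\<close>
  define N where "N = mat n n (\<lambda>(i, j). f j $ i)"
  have N: "N \<in> carrier_mat n n" by (simp add: N_def)
  have "M * N = 1\<^sub>m n"
  proof (rule eq_matI)
    fix i j assume "i < dim_row (1\<^sub>m n :: 'a mat)" "j < dim_col (1\<^sub>m n :: 'a mat)"
    then have ij: "i < n" "j < n" by auto
    have "col N j = f j" using f(1)[of j] ij by (intro eq_vecI) (auto simp: N_def)
    then have "(M * N) $$ (i, j) = (M *\<^sub>v f j) $ i" using M(1) N ij by simp
    also have "\<dots> = 1\<^sub>m n $$ (i, j)" unfolding f(2)[symmetric] using ij by simp
    finally show "(M * N) $$ (i, j) = 1\<^sub>m n $$ (i, j)" .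
  qed (use M N in auto)
  then have "det M * det N = 1" using det_mult[OF M(1) N] by simp
  moreover have "M *\<^sub>v unit_vec n (n - 1) = 0\<^sub>v n"
    using M n by (intro eq_vecI) auto
  then have "det M = 0"
    unfolding det_0_iff_vec_prod_zero[OF M(1)] using n by (intro exI[of _ "unit_vec n (n - 1)"]) auto
  ultimately show False by simp
qed

subsection \<open>Linear combinations of commuting nilpotent matrices\<close>

text \<open>This replaces the binomial theorem. Splitting off one factor \<open>X + Y\<close> raises
  either \<open>i\<close> or \<open>j\<close> by one and lowers \<open>m\<close>, so
  \<open>i + j + m\<close> is preserved. Once \<open>m = 0\<close>, either \<open>a \<le> i\<close>
  or \<open>b \<le> j\<close>.\<close>

lemma commuting_nilpotent_add_aux:
  fixes X Y :: "'a :: comm_ring_1 mat"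
  assumes X: "X \<in> carrier_mat n n" and Y: "Y \<in> carrier_mat n n" and XY: "X * Y = Y * X"
    and a: "X ^\<^sub>m a = 0\<^sub>m n n" and b: "Y ^\<^sub>m b = 0\<^sub>m n n"
  shows "a + b \<le> i + j + m \<Longrightarrow> X ^\<^sub>m i * Y ^\<^sub>m j * (X + Y) ^\<^sub>m m = 0\<^sub>m n n"
proof (induction m arbitrary: i j)
  case 0
  have "X ^\<^sub>m i * Y ^\<^sub>m j = 0\<^sub>m n n"
  proof (cases "a \<le> i")
    case True
    then have "X ^\<^sub>m i = 0\<^sub>m n n"
      using pow_mat_add[OF X, of a "i - a"] a X by (simp add: left_mult_zero_mat[OF pow_carrier_mat])
    then show ?thesis using Y by (simp add: left_mult_zero_mat[OF pow_carrier_mat])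
  next
    case False
    then have "Y ^\<^sub>m j = 0\<^sub>m n n"
      using pow_mat_add[OF Y, of b "j - b"] b Y 0 by (simp add: left_mult_zero_mat[OF pow_carrier_mat])
    then show ?thesis using X by (simp add: right_mult_zero_mat[OF pow_carrier_mat])
  qed
  then show ?case using X Y by simp
next
  case (Suc m)
  let ?Z = "(X + Y) ^\<^sub>m m"
  have Z: "?Z \<in> carrier_mat n n" using X Y by simp
  have pX: "X ^\<^sub>m k \<in> carrier_mat n n" and pY: "Y ^\<^sub>m k \<in> carrier_mat n n" for k
    using X Y by simp_all
  have comm: "Y ^\<^sub>m j * X = X * Y ^\<^sub>m j" by (rule pow_mat_commute[OF Y X]) (simp add: XY)
  \<comment> \<open>The sum commutes with its own powers, so the split-off factor can be moved next
    to \<open>Y^j\<close>.\<close>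
  have "X ^\<^sub>m i * Y ^\<^sub>m j * (X + Y) ^\<^sub>m Suc m = X ^\<^sub>m i * Y ^\<^sub>m j * ((X + Y) * ?Z)"
    using pow_mat_commute[of "X + Y" n "X + Y" m] X Y by simp
  also have "\<dots> = X ^\<^sub>m i * (Y ^\<^sub>m j * (X + Y)) * ?Z"
    using X Y Z pX pY by (simp add: assoc_mult_mat[of _ n n _ n _ n] mult_carrier_mat[of _ n n _ n])
  also have "Y ^\<^sub>m j * (X + Y) = X * Y ^\<^sub>m j + Y ^\<^sub>m Suc j"
    using mult_add_distrib_mat[OF pY X Y] comm by simp
  also have "X ^\<^sub>m i * \<dots> = X ^\<^sub>m Suc i * Y ^\<^sub>m j + X ^\<^sub>m i * Y ^\<^sub>m Suc j"
    using mult_add_distrib_mat[OF pX mult_carrier_mat[OF X pY] pY] X pX pY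
    by (simp add: assoc_mult_mat[of _ n n _ n _ n] del: pow_mat.simps)
      (simp add: assoc_mult_mat[of _ n n _ n _ n])
  also have "\<dots> * ?Z = X ^\<^sub>m Suc i * Y ^\<^sub>m j * ?Z + X ^\<^sub>m i * Y ^\<^sub>m Suc j * ?Z"
    by (rule add_mult_distrib_mat[OF mult_carrier_mat[OF pX pY] mult_carrier_mat[OF pX pY] Z])
  also have "\<dots> = 0\<^sub>m n n" using Suc.IH[of "Suc i" j] Suc.IH[of i "Suc j"] Suc.prems by simp
  finally show ?case .
qed

lemma nilpotent_mat_add:
  fixes X Y :: "'a :: comm_ring_1 mat"
  assumes X: "X \<in> carrier_mat n n" and Y: "Y \<in> carrier_mat n n" and XY: "X * Y = Y * X"
    and nil: "nilpotent_mat X" "nilpotent_mat Y"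
  shows "nilpotent_mat (X + Y)"
proof -
  obtain a b where "X ^\<^sub>m a = 0\<^sub>m n n" "Y ^\<^sub>m b = 0\<^sub>m n n"
    using nil X Y by (auto simp: nilpotent_mat_def)
  from commuting_nilpotent_add_aux[OF X Y XY this, of 0 0 "a + b"]
  have "(X + Y) ^\<^sub>m (a + b) = 0\<^sub>m n n" using X Y by simp
  then show ?thesis using X Y by (auto simp: nilpotent_mat_def)
qed

lemma smult_pow_mat:
  fixes X :: "'a :: comm_ring_1 mat"
  assumes "X \<in> carrier_mat n n"
  shows "(c \<cdot>\<^sub>m X) ^\<^sub>m k = c ^ k \<cdot>\<^sub>m X ^\<^sub>m k"
proof (induction k)
  case (Suc k)
  have "(c \<cdot>\<^sub>m X) ^\<^sub>m Suc k = (c ^ k \<cdot>\<^sub>m X ^\<^sub>m k) * (c \<cdot>\<^sub>m X)" using Suc by simp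
  also have "\<dots> = c ^ Suc k \<cdot>\<^sub>m X ^\<^sub>m Suc k"
    using assms by (intro eq_matI) (auto simp: algebra_simps)
  finally show ?case .
qed (use assms in auto)

lemma nilpotent_mat_smult:
  fixes X :: "'a :: comm_ring_1 mat"
  assumes X: "X \<in> carrier_mat n n" and nil: "nilpotent_mat X"
  shows "nilpotent_mat (c \<cdot>\<^sub>m X)"
proof -
  obtain k where "X ^\<^sub>m k = 0\<^sub>m n n" using nil X by (auto simp: nilpotent_mat_def)
  then have "(c \<cdot>\<^sub>m X) ^\<^sub>m k = 0\<^sub>m n n" unfolding smult_pow_mat[OF X] by (intro eq_matI) auto
  then show ?thesis using X by (auto simp: nilpotent_mat_def)
qed

text \<open>The cutoff \<open>k\<close> allows induction over initial segments of the list. The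
  entrywise form makes each entry visibly polynomial in the entries of the tuple.\<close>

definition lin_comb :: "nat \<Rightarrow> (nat \<Rightarrow> 'a) \<Rightarrow> nat \<Rightarrow> 'a :: comm_ring_1 mat list \<Rightarrow> 'a mat" where
  "lin_comb n c k As = mat n n (\<lambda>(i, j). \<Sum>l<k. c l * (As ! l) $$ (i, j))"

lemma lin_comb_carrier [simp]: "lin_comb n c k As \<in> carrier_mat n n"
  and lin_comb_dim [simp]: "dim_row (lin_comb n c k As) = n" "dim_col (lin_comb n c k As) = n"
  by (simp_all add: lin_comb_def)

lemma lin_comb_0: "lin_comb n c 0 As = 0\<^sub>m n n"
  by (intro eq_matI) (auto simp: lin_comb_def)

lemma lin_comb_Suc:
  "As ! k \<in> carrier_mat n n \<Longrightarrow> lin_comb n c (Suc k) As = lin_comb n c k As + c k \<cdot>\<^sub>m As ! k"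
  by (intro eq_matI) (auto simp: lin_comb_def)

lemma mat_tuples_nth: "As \<in> mat_tuples d n \<Longrightarrow> l < d \<Longrightarrow> As ! l \<in> carrier_mat n n"
  by (auto simp: mat_tuples_def)

lemma commuting_nilpotentD:
  assumes "As \<in> commuting_nilpotent_tuples d n"
  shows "As \<in> mat_tuples d n"
    and "l < d \<Longrightarrow> nilpotent_mat (As ! l)"
    and "l < d \<Longrightarrow> l' < d \<Longrightarrow> As ! l * As ! l' = As ! l' * As ! l"
  using assms by (auto simp: commuting_nilpotent_tuples_def mat_tuples_def)

lemma commuting_nilpotentI:
  assumes "As \<in> mat_tuples d n" "\<And>l. l < d \<Longrightarrow> nilpotent_mat (As ! l)"
    and "\<And>l l'. l < d \<Longrightarrow> l' < d \<Longrightarrow> As ! l * As ! l' = As ! l' * As ! l"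
  shows "As \<in> commuting_nilpotent_tuples d n"
  using assms by (auto simp: commuting_nilpotent_tuples_def mat_tuples_def in_set_conv_nth)

text \<open>Both claims go through one induction: adding the next matrix preserves nilpotency only
  because the partial sum commutes with it.\<close>

lemma lin_comb_commute_nilpotent:
  fixes As :: "'a :: field mat list"
  assumes As: "As \<in> commuting_nilpotent_tuples d n" and "k \<le> d"
  shows "(\<forall>l<d. lin_comb n c k As * As ! l = As ! l * lin_comb n c k As) \<and>
    nilpotent_mat (lin_comb n c k As)"
  using \<open>k \<le> d\<close>
proof (induction k)
  case 0
  have "nilpotent_mat (0\<^sub>m n n :: 'a mat)"
    unfolding nilpotent_mat_def by (rule exI[of _ 1]) simp
  then show ?case using mat_tuples_nth[OF commuting_nilpotentD(1)[OF As]]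
    by (simp add: lin_comb_0 left_mult_zero_mat[of _ n n] right_mult_zero_mat[of _ n n])
next
  case (Suc k)
  note carrier = mat_tuples_nth[OF commuting_nilpotentD(1)[OF As]]
  have k: "As ! k \<in> carrier_mat n n" "k < d" using carrier Suc.prems by auto
  have IH: "\<And>l. l < d \<Longrightarrow> lin_comb n c k As * As ! l = As ! l * lin_comb n c k As"
    "nilpotent_mat (lin_comb n c k As)" using Suc by auto
  have "lin_comb n c k As * (c k \<cdot>\<^sub>m As ! k) = (c k \<cdot>\<^sub>m As ! k) * lin_comb n c k As"
    using k IH(1)[OF k(2)] by (simp add: mult_smult_distrib[of _ n n _ n] mult_smult_assoc_mat[of _ n n _ n])
  then have "nilpotent_mat (lin_comb n c (Suc k) As)"
    unfolding lin_comb_Suc[OF k(1)]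
    using k IH(2) commuting_nilpotentD(2)[OF As k(2)]
    by (intro nilpotent_mat_add[of _ n] nilpotent_mat_smult[of _ n]) auto
  moreover have "lin_comb n c (Suc k) As * As ! l = As ! l * lin_comb n c (Suc k) As" if l: "l < d" for l
    unfolding lin_comb_Suc[OF k(1)]
    using k carrier[OF l] IH(1)[OF l] commuting_nilpotentD(3)[OF As k(2) l]
    by (simp add: mult_smult_distrib[of _ n n _ n] mult_smult_assoc_mat[of _ n n _ n]
        mult_add_distrib_mat[of _ n n _ n] add_mult_distrib_mat[of _ n n _ _ n])
  ultimately show ?case by blast
qed

abbreviation mat_span :: "nat \<Rightarrow> 'a :: field mat set \<Rightarrow> 'a mat set" where
  "mat_span n \<equiv> LinearCombinations.module.span class_ring (module_mat TYPE('a) n n)"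

text \<open>One inclusion is an induction on the number of summands; for the other, the combinations
  form a submodule that contains each \<open>As ! l\<close>. Coefficients are indexed by position,
  so a matrix may occur repeatedly in the list.\<close>

lemma mat_span_eq_lin_comb:
  fixes As :: "'a :: field mat list"
  assumes As: "As \<in> mat_tuples d n"
  shows "mat_span n (set As) = range (\<lambda>c. lin_comb n c d As)"
proof
  interpret V: vectorspace class_ring "module_mat TYPE('a) n n" by (rule matrix_vs)
  have car: "As ! l \<in> carrier_mat n n" if "l < d" for l by (rule mat_tuples_nth[OF As that])
  have sub: "set As \<subseteq> carrier (module_mat TYPE('a) n n)"
    using As by (auto simp: mat_tuples_def module_mat_simps)
  show "range (\<lambda>c. lin_comb n c d As) \<subseteq> mat_span n (set As)"
  proof (rule image_subsetI)
    fix c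
    have "lin_comb n c k As \<in> mat_span n (set As)" if "k \<le> d" for k
      using that
    proof (induction k)
      case 0
      have "\<zero>\<^bsub>module_mat TYPE('a) n n\<^esub> \<in> mat_span n (set As)"
        using V.span_is_submodule[OF sub] by (auto simp: submodule_def)
      then show ?case by (simp add: lin_comb_0 module_mat_simps)
    next
      case (Suc k)
      then have k: "k < d" by simp
      have "As ! k \<in> mat_span n (set As)"
        using V.in_own_span[OF sub] k As by (auto simp: mat_tuples_def)
      then have "c k \<cdot>\<^sub>m As ! k \<in> mat_span n (set As)"
        using submodule.smult_closed[OF V.span_is_submodule[OF sub], of "c k" "As ! k"]
        by (simp add: matrix_vs_simps)
      then show ?case
        using V.span_add1[OF sub, of "lin_comb n c k As" "c k \<cdot>\<^sub>m As ! k"] Suc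
        unfolding lin_comb_Suc[OF car[OF k]] by (simp add: matrix_vs_simps)
    qed
    then show "lin_comb n c d As \<in> mat_span n (set As)" by simp
  qed
  have "submodule class_ring (range (\<lambda>c. lin_comb n c d As)) (module_mat TYPE('a) n n)"
  proof (intro LinearCombinations.submodule.intro)
    show "module class_ring (module_mat TYPE('a) n n)" by (rule V.module_axioms)
    show "range (\<lambda>c. lin_comb n c d As) \<subseteq> carrier (module_mat TYPE('a) n n)"
      by (auto simp: matrix_vs_simps)
    fix v w assume "v \<in> range (\<lambda>c. lin_comb n c d As)" "w \<in> range (\<lambda>c. lin_comb n c d As)"
    then obtain a b where "v = lin_comb n a d As" "w = lin_comb n b d As" by blast
    then have "v + w = lin_comb n (\<lambda>l. a l + b l) d As"
      by (intro eq_matI) (auto simp: lin_comb_def sum.distrib algebra_simps)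
    then show "v \<oplus>\<^bsub>module_mat TYPE('a) n n\<^esub> w \<in> range (\<lambda>c. lin_comb n c d As)"
      by (auto simp: matrix_vs_simps)
  next
    have "0\<^sub>m n n = lin_comb n (\<lambda>_. 0) d As" by (intro eq_matI) (auto simp: lin_comb_def)
    then show "\<zero>\<^bsub>module_mat TYPE('a) n n\<^esub> \<in> range (\<lambda>c. lin_comb n c d As)"
      by (simp add: matrix_vs_simps)
  next
    fix a :: 'a and v assume "v \<in> range (\<lambda>c. lin_comb n c d As)"
    then obtain b where "v = lin_comb n b d As" by blast
    then have "a \<cdot>\<^sub>m v = lin_comb n (\<lambda>l. a * b l) d As"
      by (intro eq_matI) (auto simp: lin_comb_def sum_distrib_left algebra_simps)
    then show "a \<odot>\<^bsub>module_mat TYPE('a) n n\<^esub> v \<in> range (\<lambda>c. lin_comb n c d As)"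
      by (auto simp: matrix_vs_simps)
  qed
  moreover have "set As \<subseteq> range (\<lambda>c. lin_comb n c d As)"
  proof
    fix A assume "A \<in> set As"
    then obtain l where l: "l < d" "A = As ! l" using As by (auto simp: mat_tuples_def in_set_conv_nth)
    have "A = lin_comb n (\<lambda>k. if k = l then 1 else 0) d As"
      using car[OF l(1)] l by (intro eq_matI) (auto simp: lin_comb_def if_distrib[of "\<lambda>x. x * _"] cong: if_cong)
    then show "A \<in> range (\<lambda>c. lin_comb n c d As)" by blast
  qed
  ultimately show "mat_span n (set As) \<subseteq> range (\<lambda>c. lin_comb n c d As)"
    by (rule V.span_is_subset[rotated])
qed

text \<open>For each fixed \<open>c\<close> the right side asks that some polynomial in the entries
  of \<open>As\<close> be nonzero. In this form \<open>one_regular_tuples\<close> is seen to be open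
  in \<open>commuting_nilpotent_tuples\<close>.\<close>

lemma one_regular_tuples_iff:
  fixes As :: "'a :: field mat list"
  assumes As: "As \<in> commuting_nilpotent_tuples d n" and n: "n > 0"
  shows "As \<in> one_regular_tuples d n \<longleftrightarrow> (\<exists>c. lin_comb n c d As ^\<^sub>m (n - 1) \<noteq> 0\<^sub>m n n)"
proof -
  have "one_regular (lin_comb n c d As) \<longleftrightarrow> lin_comb n c d As ^\<^sub>m (n - 1) \<noteq> 0\<^sub>m n n" for c
    using max_rank_imp_one_regular[of "lin_comb n c d As" n]
      one_regular_imp_max_rank[of "lin_comb n c d As" n] n
      lin_comb_commute_nilpotent[OF As order_refl, of c] by auto
  then show ?thesis
    using As mat_span_eq_lin_comb[OF commuting_nilpotentD(1)[OF As]]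
    by (auto simp: one_regular_tuples_def)
qed

subsection \<open>Simultaneously Toeplitz tuples\<close>

lemma mat_right_cancel:
  fixes P :: "'a :: field mat"
  assumes "A \<in> carrier_mat n n" "B \<in> carrier_mat n n" "P \<in> carrier_mat n n" "det P \<noteq> 0"
    and "A * P = B * P"
  shows "A = B"
proof -
  obtain Q where Q: "Q \<in> carrier_mat n n" "P * Q = 1\<^sub>m n"
    using det_nonzero_obtain_inverse[OF assms(3,4)] by blast
  have "A * (P * Q) = B * (P * Q)"
    using assoc_mult_mat[OF assms(1,3) Q(1)] assoc_mult_mat[OF assms(2,3) Q(1)] assms(5) by argo
  then show ?thesis using assms Q by simp
qed

lemma mat_left_cancel:
  fixes P :: "'a :: field mat"
  assumes "A \<in> carrier_mat n n" "B \<in> carrier_mat n n" "P \<in> carrier_mat n n" "det P \<noteq> 0"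
    and "P * A = P * B"
  shows "A = B"
proof -
  obtain Q where Q: "Q \<in> carrier_mat n n" "Q * P = 1\<^sub>m n"
    using det_nonzero_obtain_inverse[OF assms(3,4)] by blast
  have "Q * P * A = Q * P * B"
    using assoc_mult_mat[OF Q(1) assms(3,1)] assoc_mult_mat[OF Q(1) assms(3,2)] assms(5) by argo
  then show ?thesis using assms Q by simp
qed

lemma intertwine_pow:
  assumes "A \<in> carrier_mat n n" "P \<in> carrier_mat n n" "T \<in> carrier_mat n n" "A * P = P * T"
  shows "A ^\<^sub>m k * P = P * T ^\<^sub>m k"
proof (induction k)
  case (Suc k)
  have "A ^\<^sub>m Suc k * P = A ^\<^sub>m k * P * T"
    using assms by (simp add: assoc_mult_mat[of _ n n _ n _ n])
  also have "\<dots> = P * T ^\<^sub>m Suc k"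
    unfolding Suc using assms by (simp add: assoc_mult_mat[of _ n n _ n _ n])
  finally show ?case .
qed (use assms in auto)

text \<open>With \<open>J\<close> the nilpotent Jordan block, this is the sum of \<open>c k\<close>
  times \<open>J^k\<close> over \<open>0 < k < n\<close>, a polynomial in \<open>J\<close> without
  constant term.\<close>

definition toeplitz_mat :: "nat \<Rightarrow> (nat \<Rightarrow> 'a) \<Rightarrow> 'a :: comm_ring_1 mat" where
  "toeplitz_mat n c = mat n n (\<lambda>(i, j). if i < j then c (j - i) else 0)"

lemma toeplitz_mat_carrier [simp]: "toeplitz_mat n c \<in> carrier_mat n n"
  and toeplitz_mat_dim [simp]: "dim_row (toeplitz_mat n c) = n" "dim_col (toeplitz_mat n c) = n"
  by (simp_all add: toeplitz_mat_def)

lemma toeplitz_mult_index: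
  assumes "i < n" "j < n"
  shows "(toeplitz_mat n a * toeplitz_mat n b) $$ (i, j) = (\<Sum>k\<in>{i<..<j}. a (k - i) * b (j - k))"
proof -
  have "(toeplitz_mat n a * toeplitz_mat n b) $$ (i, j)
      = (\<Sum>k = 0..<n. toeplitz_mat n a $$ (i, k) * toeplitz_mat n b $$ (k, j))"
    using assms by (simp add: scalar_prod_def)
  also have "\<dots> = (\<Sum>k\<in>{i<..<j}. toeplitz_mat n a $$ (i, k) * toeplitz_mat n b $$ (k, j))"
    using assms by (intro sum.mono_neutral_right) (auto simp: toeplitz_mat_def)
  also have "\<dots> = (\<Sum>k\<in>{i<..<j}. a (k - i) * b (j - k))"
    using assms by (intro sum.cong) (auto simp: toeplitz_mat_def)
  finally show ?thesis .
qed

lemma toeplitz_mat_commute: "toeplitz_mat n a * toeplitz_mat n b = toeplitz_mat n b * toeplitz_mat n a"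
proof (rule eq_matI)
  fix i j assume "i < dim_row (toeplitz_mat n b * toeplitz_mat n a)"
    "j < dim_col (toeplitz_mat n b * toeplitz_mat n a)"
  then have ij: "i < n" "j < n" by auto
  \<comment> \<open>The reflection \<open>k \<mapsto> i + j - k\<close> of the interval exchanges
    \<open>k - i\<close> and \<open>j - k\<close>.\<close>
  have "(\<Sum>k\<in>{i<..<j}. a (k - i) * b (j - k)) = (\<Sum>k\<in>{i<..<j}. b (k - i) * a (j - k))"
    by (rule sum.reindex_bij_witness[of _ "\<lambda>k. i + j - k" "\<lambda>k. i + j - k"]) (auto simp: mult.commute)
  then show "(toeplitz_mat n a * toeplitz_mat n b) $$ (i, j)
      = (toeplitz_mat n b * toeplitz_mat n a) $$ (i, j)"
    by (simp add: toeplitz_mult_index[OF ij])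
qed auto

lemma toeplitz_mat_pow_zero: "toeplitz_mat n c ^\<^sub>m n = 0\<^sub>m n n"
proof -
  \<comment> \<open>Each factor pushes the support one superdiagonal further up; at
    \<open>k = n\<close> nothing remains.\<close>
  have "(toeplitz_mat n c ^\<^sub>m k) $$ (i, j) = 0" if "i < n" "j < n" "j < i + k" for i j k
    using that
  proof (induction k arbitrary: i j)
    case (Suc k)
    have "(toeplitz_mat n c ^\<^sub>m Suc k) $$ (i, j)
        = (\<Sum>l = 0..<n. (toeplitz_mat n c ^\<^sub>m k) $$ (i, l) * toeplitz_mat n c $$ (l, j))"
      using Suc.prems by (simp add: scalar_prod_def)
    also have "\<dots> = 0"
    proof (intro sum.neutral ballI)
      fix l assume "l \<in> {0..<n}"
      then show "(toeplitz_mat n c ^\<^sub>m k) $$ (i, l) * toeplitz_mat n c $$ (l, j) = 0"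
        using Suc.IH[of i l] Suc.prems by (cases "l < j") (auto simp: toeplitz_mat_def)
    qed
    finally show ?case .
  qed simp
  then show ?thesis by (intro eq_matI) auto
qed

text \<open>Comparing the entries of both products at \<open>(i, j)\<close> gives
  \<open>X $$ (Suc i, j) = X $$ (i, j - 1)\<close>, with \<open>0\<close> in place of the right side
  when \<open>j = 0\<close>. So entries are constant along diagonals and vanish below the main
  one.\<close>

lemma commute_jordan_block_index:
  fixes X :: "'a :: comm_ring_1 mat"
  assumes X: "X \<in> carrier_mat n n" and comm: "X * jordan_block n 0 = jordan_block n 0 * X"
  shows "i < n \<Longrightarrow> j < n \<Longrightarrow> X $$ (i, j) = (if i \<le> j then X $$ (0, j - i) else 0)"
proof (induction i arbitrary: j)
  case (Suc i)
  have "X $$ (Suc i, j) = (if j = 0 then 0 else X $$ (i, j - 1))"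
    using mult_jordan_block_index[OF X, of i j] jordan_block_mult_index[OF X, of i j] comm Suc.prems
    by simp
  then show ?case using Suc.IH[of "j - 1"] Suc.prems by auto
qed simp

text \<open>By \<open>commute_jordan_block_index\<close> only the constant diagonal is in question.
  As the first column vanishes below the diagonal, the corner entry of \<open>X^k\<close> is the
  \<open>k\<close>-th power of that of \<open>X\<close>, and nilpotency makes it zero.\<close>

lemma nilpotent_commute_jordan_block:
  fixes X :: "'a :: field mat"
  assumes X: "X \<in> carrier_mat n n" and comm: "X * jordan_block n 0 = jordan_block n 0 * X"
    and nil: "X ^\<^sub>m m = 0\<^sub>m n n"
  shows "X = toeplitz_mat n (\<lambda>k. X $$ (0, k))"
proof -
  note idx = commute_jordan_block_index[OF X comm]
  have diag: "X $$ (0, 0) = 0" if "n > 0"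
  proof -
    have col0: "X $$ (l, 0) = 0" if "l < n" "l \<noteq> 0" for l
      using idx[OF that(1) \<open>n > 0\<close>] that(2) by simp
    have "(X ^\<^sub>m k) $$ (0, 0) = X $$ (0, 0) ^ k" for k
    proof (induction k)
      case (Suc k)
      have "(X ^\<^sub>m Suc k) $$ (0, 0) = (\<Sum>l = 0..<n. (X ^\<^sub>m k) $$ (0, l) * X $$ (l, 0))"
        using X that by (simp add: scalar_prod_def)
      also have "\<dots> = (\<Sum>l = 0..<n. if l = 0 then (X ^\<^sub>m k) $$ (0, 0) * X $$ (0, 0) else 0)"
        using col0 by (intro sum.cong) auto
      also have "\<dots> = X $$ (0, 0) ^ Suc k" using Suc that by simp
      finally show ?case .
    qed (use X that in simp)
    then have "X $$ (0, 0) ^ m = 0" using nil that by (metis index_zero_mat(1))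
    then show ?thesis by simp
  qed
  show ?thesis
  proof (rule eq_matI)
    fix i j assume "i < dim_row (toeplitz_mat n (\<lambda>k. X $$ (0, k)))"
      "j < dim_col (toeplitz_mat n (\<lambda>k. X $$ (0, k)))"
    then have ij: "i < n" "j < n" by auto
    show "X $$ (i, j) = toeplitz_mat n (\<lambda>k. X $$ (0, k)) $$ (i, j)"
      unfolding idx[OF ij] using ij diag by (auto simp: toeplitz_mat_def)
  qed (use X in auto)
qed

text \<open>This is the set \<open>W\<close> of the introduction, with one \<open>P\<close> common
  to all members of the tuple. The intertwining form of conjugacy avoids inverse matrices.\<close>

definition toeplitz_tuples :: "nat \<Rightarrow> nat \<Rightarrow> 'a :: field mat list set" where
  "toeplitz_tuples d n = {As \<in> mat_tuples d n. \<exists>P \<in> carrier_mat n n. det P \<noteq> 0 \<and>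
     (\<exists>c. \<forall>l<d. As ! l * P = P * toeplitz_mat n (c l))}"

lemma toeplitz_tuples_subset: "toeplitz_tuples d n \<subseteq> commuting_nilpotent_tuples d n"
proof
  fix As :: "'a mat list" assume As: "As \<in> toeplitz_tuples d n"
  then obtain P c where tup: "As \<in> mat_tuples d n" and P: "P \<in> carrier_mat n n" "det P \<noteq> 0"
    and AP: "\<And>l. l < d \<Longrightarrow> As ! l * P = P * toeplitz_mat n (c l)"
    unfolding toeplitz_tuples_def by blast
  note car = mat_tuples_nth[OF tup]
  show "As \<in> commuting_nilpotent_tuples d n"
  proof (rule commuting_nilpotentI[OF tup])
    fix l assume l: "l < d"
    have "As ! l ^\<^sub>m n * P = P * toeplitz_mat n (c l) ^\<^sub>m n"
      by (rule intertwine_pow[OF car[OF l] P(1) toeplitz_mat_carrier AP[OF l]])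
    then have "As ! l ^\<^sub>m n * P = 0\<^sub>m n n * P"
      using P(1) by (simp add: toeplitz_mat_pow_zero)
    then have "As ! l ^\<^sub>m n = 0\<^sub>m n n"
      by (rule mat_right_cancel[OF pow_carrier_mat[OF car[OF l]] zero_carrier_mat P])
    then show "nilpotent_mat (As ! l)" using car[OF l] by (auto simp: nilpotent_mat_def)
  next
    fix l l' assume l: "l < d" "l' < d"
    have prod: "As ! i * As ! j * P = P * (toeplitz_mat n (c i) * toeplitz_mat n (c j))"
      if "i < d" "j < d" for i j
    proof -
      have "As ! i * As ! j * P = As ! i * P * toeplitz_mat n (c j)"
        using car[OF that(1)] car[OF that(2)] P(1) AP[OF that(2)]
        by (simp add: assoc_mult_mat[of _ n n _ n _ n])
      then show ?thesis
        using AP[OF that(1)] P(1) by (simp add: assoc_mult_mat[of _ n n _ n _ n])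
    qed
    have "As ! l * As ! l' * P = As ! l' * As ! l * P"
      using prod[OF l] prod[OF l(2,1)] toeplitz_mat_commute[of n "c l" "c l'"] by simp
    then show "As ! l * As ! l' = As ! l' * As ! l"
      by (rule mat_right_cancel[OF _ _ P, rotated 2]) (use car[OF l(1)] car[OF l(2)] in auto)
  qed
qed

text \<open>Bring one combination of maximal nilpotency index into Jordan form by \<open>P\<close>.
  Every \<open>As ! l\<close> commutes with it, so its conjugate \<open>X l\<close> commutes with
  the Jordan block and, being nilpotent, is strictly upper triangular Toeplitz.\<close>

lemma one_regular_tuples_subset_toeplitz:
  assumes n: "n > 0"
  shows "one_regular_tuples d n \<subseteq> (toeplitz_tuples d n :: 'a :: field mat list set)"
proof
  fix As :: "'a mat list" assume reg: "As \<in> one_regular_tuples d n"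
  then have As: "As \<in> commuting_nilpotent_tuples d n" by (simp add: one_regular_tuples_def)
  note tup = commuting_nilpotentD(1)[OF As]
  note car = mat_tuples_nth[OF tup]
  obtain b where top: "lin_comb n b d As ^\<^sub>m (n - 1) \<noteq> 0\<^sub>m n n"
    using reg one_regular_tuples_iff[OF As n] by blast
  let ?B = "lin_comb n b d As" and ?J = "jordan_block n (0 :: 'a)"
  have comm: "?B * As ! l = As ! l * ?B" if "l < d" for l
    using lin_comb_commute_nilpotent[OF As order_refl] that by blast
  have "nilpotent_mat ?B" using lin_comb_commute_nilpotent[OF As order_refl] by blast
  then obtain P where P: "P \<in> carrier_mat n n" "det P \<noteq> 0" "?B * P = P * ?J"
    using nilpotent_max_rank_jordan[OF lin_comb_carrier _ top] by blast
  obtain Q where Q: "Q \<in> carrier_mat n n" "P * Q = 1\<^sub>m n"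
    using det_nonzero_obtain_inverse[OF P(1,2)] by blast
  define X where "X = (\<lambda>l. Q * (As ! l * P))"
  have X: "X l \<in> carrier_mat n n" if "l < d" for l
    using Q(1) P(1) car[OF that] by (simp add: X_def)
  have PX: "As ! l * P = P * X l" if "l < d" for l
  proof -
    have "P * X l = P * Q * (As ! l * P)"
      unfolding X_def using Q(1) P(1) car[OF that] by (intro assoc_mult_mat[symmetric]) auto
    then show ?thesis using Q(2) P(1) car[OF that] by simp
  qed
  have toep: "X l = toeplitz_mat n (\<lambda>k. X l $$ (0, k))" if l: "l < d" for l
  proof (rule nilpotent_commute_jordan_block[OF X[OF l]])
    have "P * (X l * ?J) = As ! l * P * ?J"
      using X[OF l] P(1) by (simp add: PX[OF l] assoc_mult_mat[of _ n n _ n _ n])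
    also have "\<dots> = As ! l * ?B * P"
      using P(1,3) car[OF l] by (simp add: assoc_mult_mat[of _ n n _ n _ n])
    also have "\<dots> = ?B * (P * X l)"
      using P(1) car[OF l] by (simp add: comm[OF l, symmetric] PX[OF l] assoc_mult_mat[of _ n n _ n _ n])
    also have "\<dots> = P * (?J * X l)"
      using P(1,3) X[OF l] by (simp flip: assoc_mult_mat[of _ n n _ n _ n])
    finally show "X l * ?J = ?J * X l"
      by (rule mat_left_cancel[OF _ _ P(1,2), rotated 2]) (use X[OF l] in auto)
    have "P * X l ^\<^sub>m n = As ! l ^\<^sub>m n * P"
      by (rule intertwine_pow[OF car[OF l] P(1) X[OF l] PX[OF l], symmetric])
    also have "\<dots> = P * 0\<^sub>m n n"
      unfolding nilpotent_pow_dim[OF car[OF l] commuting_nilpotentD(2)[OF As l]] using P(1) by simp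
    finally show "X l ^\<^sub>m n = 0\<^sub>m n n"
      by (rule mat_left_cancel[OF pow_carrier_mat[OF X[OF l]] zero_carrier_mat P(1,2)])
  qed
  have "As ! l * P = P * toeplitz_mat n (\<lambda>k. X l $$ (0, k))" if "l < d" for l
    using PX[OF that] by (rule trans) (rule arg_cong[OF toep[OF that]])
  then show "As \<in> toeplitz_tuples d n"
    unfolding toeplitz_tuples_def using tup P(1,2)
    by (intro CollectI conjI bexI[of _ P] exI[of _ "\<lambda>l k. X l $$ (0, k)"]) auto
qed

subsection \<open>Density and irreducibility\<close>

text \<open>As in Euclid's argument: over a finite field the product of all \<open>x - a\<close>,
  plus one, has positive degree but no root.\<close>

lemma infinite_UNIV_alg_closed: "infinite (UNIV :: 'a :: alg_closed_field set)"
proof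
  assume fin: "finite (UNIV :: 'a set)"
  define p where "p = (\<Prod>a\<in>(UNIV :: 'a set). [:- a, 1:])"
  have "poly (p + 1) x = 1" for x
    using fin by (simp add: p_def poly_prod prod_zero_iff)
  moreover have "degree p = card (UNIV :: 'a set)"
    unfolding p_def by (subst degree_prod_sum_eq) auto
  then have "degree p > 0" using fin by (simp add: card_gt_0_iff)
  then have "degree (p + 1) > 0" by (subst degree_add_eq_left) auto
  then have "\<exists>x. poly (p + 1) x = 0" by (rule alg_closed_imp_poly_has_root)
  ultimately show False by auto
qed

text \<open>Entries of matrix products are polynomial only where the dimensions fit, hence the restriction
  to \<open>mat_tuples d n\<close>.\<close>

definition regular_on :: "nat \<Rightarrow> nat \<Rightarrow> ('a :: comm_ring_1 mat list \<Rightarrow> 'a) \<Rightarrow> bool" where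
  "regular_on d n f \<longleftrightarrow> (\<exists>p \<in> poly_funs d n. \<forall>As \<in> mat_tuples d n. f As = p As)"

lemma regular_on_const: "regular_on d n (\<lambda>_. c)"
  unfolding regular_on_def by (rule bexI[OF _ poly_funs.const]) auto

lemma regular_on_entry: "l < d \<Longrightarrow> i < n \<Longrightarrow> j < n \<Longrightarrow> regular_on d n (\<lambda>As. (As ! l) $$ (i, j))"
  unfolding regular_on_def by (rule bexI[of _ "\<lambda>As. (As ! l) $$ (i, j)"]) (auto intro: poly_funs.entry)

lemma regular_on_add:
  assumes "regular_on d n f" "regular_on d n g"
  shows "regular_on d n (\<lambda>As. f As + g As)"
proof -
  obtain p q where "p \<in> poly_funs d n" "\<forall>As \<in> mat_tuples d n. f As = p As"
    "q \<in> poly_funs d n" "\<forall>As \<in> mat_tuples d n. g As = q As"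
    using assms unfolding regular_on_def by blast
  then show ?thesis
    unfolding regular_on_def by (intro bexI[OF _ poly_funs.add[of p d n q]]) auto
qed

lemma regular_on_mult:
  assumes "regular_on d n f" "regular_on d n g"
  shows "regular_on d n (\<lambda>As. f As * g As)"
proof -
  obtain p q where "p \<in> poly_funs d n" "\<forall>As \<in> mat_tuples d n. f As = p As"
    "q \<in> poly_funs d n" "\<forall>As \<in> mat_tuples d n. g As = q As"
    using assms unfolding regular_on_def by blast
  then show ?thesis
    unfolding regular_on_def by (intro bexI[OF _ poly_funs.mult[of p d n q]]) auto
qed

lemma regular_on_diff:
  assumes "regular_on d n f" "regular_on d n g"
  shows "regular_on d n (\<lambda>As. f As - g As)"
  using regular_on_add[OF assms(1) regular_on_mult[OF regular_on_const[of d n "-1"] assms(2)]] by simp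

lemma regular_on_sum:
  assumes "\<And>k. k \<in> K \<Longrightarrow> regular_on d n (f k)"
  shows "regular_on d n (\<lambda>As. \<Sum>k\<in>K. f k As)"
  using assms by (induction K rule: infinite_finite_induct) (auto intro: regular_on_const regular_on_add)

lemma regular_on_cong:
  assumes "regular_on d n f" "\<And>As. As \<in> mat_tuples d n \<Longrightarrow> g As = f As"
  shows "regular_on d n g"
  using assms unfolding regular_on_def by auto

definition regular_mat_on :: "nat \<Rightarrow> nat \<Rightarrow> ('a :: comm_ring_1 mat list \<Rightarrow> 'a mat) \<Rightarrow> bool" where
  "regular_mat_on d n M \<longleftrightarrow> (\<forall>As \<in> mat_tuples d n. M As \<in> carrier_mat n n) \<and>
     (\<forall>i<n. \<forall>j<n. regular_on d n (\<lambda>As. M As $$ (i, j)))"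

lemma regular_mat_on_nth: "l < d \<Longrightarrow> regular_mat_on d n (\<lambda>As. As ! l)"
  using regular_on_entry mat_tuples_nth by (fastforce simp: regular_mat_on_def)

lemma regular_mat_on_lin_comb: "regular_mat_on d n (lin_comb n c d)"
  unfolding regular_mat_on_def lin_comb_def
  by (auto intro!: regular_on_sum regular_on_mult regular_on_const regular_on_entry)

lemma regular_mat_on_mult:
  assumes M: "regular_mat_on d n M" and N: "regular_mat_on d n N"
  shows "regular_mat_on d n (\<lambda>As. M As * N As)"
  unfolding regular_mat_on_def
proof (intro conjI ballI allI impI)
  fix As :: "'a mat list" assume "As \<in> mat_tuples d n"
  then show "M As * N As \<in> carrier_mat n n"
    using M N by (auto simp: regular_mat_on_def intro: mult_carrier_mat)
next
  fix i j assume ij: "i < n" "j < n"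
  have "regular_on d n (\<lambda>As. \<Sum>k = 0..<n. M As $$ (i, k) * N As $$ (k, j))"
    using M N ij by (intro regular_on_sum regular_on_mult) (auto simp: regular_mat_on_def)
  then show "regular_on d n (\<lambda>As. (M As * N As) $$ (i, j))"
  proof (rule regular_on_cong)
    fix As :: "'a mat list" assume "As \<in> mat_tuples d n"
    then have "M As \<in> carrier_mat n n" "N As \<in> carrier_mat n n"
      using M N by (auto simp: regular_mat_on_def)
    then show "(M As * N As) $$ (i, j) = (\<Sum>k = 0..<n. M As $$ (i, k) * N As $$ (k, j))"
      using ij by (simp add: scalar_prod_def)
  qed
qed

lemma regular_mat_on_pow:
  assumes M: "regular_mat_on d n M"
  shows "regular_mat_on d n (\<lambda>As. M As ^\<^sub>m k)"
proof (induction k)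
  case 0
  have car: "M As \<in> carrier_mat n n" if "As \<in> mat_tuples d n" for As
    using M that by (auto simp: regular_mat_on_def)
  have "regular_on d n (\<lambda>As. (M As ^\<^sub>m 0) $$ (i, j))" if "i < n" "j < n" for i j
    using car that by (intro regular_on_cong[OF regular_on_const[of d n "1\<^sub>m n $$ (i, j)"]]) fastforce
  then show ?case using car by (auto simp: regular_mat_on_def simp del: pow_mat.simps)
next
  case (Suc k)
  then show ?case using regular_mat_on_mult[OF Suc M] by simp
qed

section \<open>Closed sets defined by equations between regular matrices\<close>

lemma closedin_regular:
  fixes F :: "('a :: idom mat list \<Rightarrow> 'a) set"
  assumes "\<And>f. f \<in> F \<Longrightarrow> regular_on d n f"
  shows "closedin (zariski d n) {As \<in> mat_tuples d n. \<forall>f\<in>F. f As = 0}"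
proof -
  obtain p where p: "\<And>f. f \<in> F \<Longrightarrow> p f \<in> poly_funs d n"
    "\<And>f As. f \<in> F \<Longrightarrow> As \<in> mat_tuples d n \<Longrightarrow> f As = p f As"
    using assms unfolding regular_on_def by metis
  have "{As \<in> mat_tuples d n. \<forall>f\<in>F. f As = 0} = zero_locus d n (p ` F)"
    using p(2) by (auto simp: zero_locus_def)
  then show ?thesis unfolding closedin_zariski using p(1) by (intro exI[of _ "p ` F"]) auto
qed

text \<open>The index set \<open>I\<close> may be infinite, since
  \<open>closedin_not_one_regular\<close> imposes one equation for each coefficient
  function.\<close>

lemma closedin_regular_mat_eq:
  fixes M N :: "'i \<Rightarrow> 'a :: idom mat list \<Rightarrow> 'a mat"
  assumes "\<And>x. x \<in> I \<Longrightarrow> regular_mat_on d n (M x)" "\<And>x. x \<in> I \<Longrightarrow> regular_mat_on d n (N x)"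
  shows "closedin (zariski d n) {As \<in> mat_tuples d n. \<forall>x\<in>I. M x As = N x As}"
proof -
  define F where "F = (\<lambda>(x, i, j) As. M x As $$ (i, j) - N x As $$ (i, j)) ` (I \<times> {..<n} \<times> {..<n})"
  have "closedin (zariski d n) {As \<in> mat_tuples d n. \<forall>f\<in>F. f As = 0}"
    using assms by (intro closedin_regular) (auto simp: F_def regular_mat_on_def intro!: regular_on_diff)
  also have "{As \<in> mat_tuples d n. \<forall>f\<in>F. f As = 0} = {As \<in> mat_tuples d n. \<forall>x\<in>I. M x As = N x As}"
  proof (intro Collect_cong conj_cong refl)
    fix As :: "'a mat list" assume As: "As \<in> mat_tuples d n"
    have eq: "M x As = N x As \<longleftrightarrow> (\<forall>i<n. \<forall>j<n. M x As $$ (i, j) - N x As $$ (i, j) = 0)" if "x \<in> I" for x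
    proof -
      have "M x As \<in> carrier_mat n n" "N x As \<in> carrier_mat n n"
        using assms[OF that] As by (auto simp: regular_mat_on_def)
      then show ?thesis by (auto intro!: eq_matI)
    qed
    have "(\<forall>f\<in>F. f As = 0) \<longleftrightarrow> (\<forall>x\<in>I. \<forall>i<n. \<forall>j<n. M x As $$ (i, j) - N x As $$ (i, j) = 0)"
      by (auto simp: F_def)
    then show "(\<forall>f\<in>F. f As = 0) \<longleftrightarrow> (\<forall>x\<in>I. M x As = N x As)" using eq by simp
  qed
  finally show ?thesis .
qed

lemma regular_mat_on_zero: "regular_mat_on d n (\<lambda>_. 0\<^sub>m n n)"
  by (auto simp: regular_mat_on_def intro: regular_on_const)

text \<open>By \<open>nilpotent_pow_dim\<close> the unspecified exponent in the definition of
  nilpotency can be fixed to \<open>n\<close>, which leaves polynomial equations.\<close>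

lemma closedin_commuting_nilpotent:
  "closedin (zariski d n) (commuting_nilpotent_tuples d n :: 'a :: field mat list set)"
proof -
  have nil: "closedin (zariski d n) {As \<in> mat_tuples d n. \<forall>l\<in>{..<d}. As ! l ^\<^sub>m n = (0\<^sub>m n n :: 'a mat)}"
    by (intro closedin_regular_mat_eq regular_mat_on_pow regular_mat_on_nth regular_mat_on_zero) simp
  have "closedin (zariski d n) {As :: 'a mat list \<in> mat_tuples d n. \<forall>x\<in>{..<d} \<times> {..<d}.
      As ! fst x * As ! snd x = As ! snd x * As ! fst x}"
    by (intro closedin_regular_mat_eq regular_mat_on_mult regular_mat_on_nth) auto
  note closedin_Int[OF nil this]
  also have "{As \<in> mat_tuples d n. \<forall>l\<in>{..<d}. As ! l ^\<^sub>m n = (0\<^sub>m n n :: 'a mat)} \<inter>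
      {As \<in> mat_tuples d n. \<forall>x\<in>{..<d} \<times> {..<d}. As ! fst x * As ! snd x = As ! snd x * As ! fst x}
      = commuting_nilpotent_tuples d n" (is "?L = _")
  proof (intro equalityI subsetI)
    fix As assume "As \<in> ?L"
    then have As: "As \<in> mat_tuples d n" "\<And>l. l < d \<Longrightarrow> As ! l ^\<^sub>m n = 0\<^sub>m n n"
      "\<And>l l'. l < d \<Longrightarrow> l' < d \<Longrightarrow> As ! l * As ! l' = As ! l' * As ! l"
      by auto
    have "nilpotent_mat (As ! l)" if "l < d" for l
      using As(2)[OF that] mat_tuples_nth[OF As(1) that] by (auto simp: nilpotent_mat_def)
    then show "As \<in> commuting_nilpotent_tuples d n"
      using As(1,3) by (intro commuting_nilpotentI)
  next
    fix As :: "'a mat list" assume As: "As \<in> commuting_nilpotent_tuples d n"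
    show "As \<in> ?L"
      using commuting_nilpotentD[OF As] nilpotent_pow_dim[OF mat_tuples_nth[OF commuting_nilpotentD(1)[OF As]]]
      by auto
  qed
  finally show ?thesis .
qed

lemma closedin_not_one_regular:
  assumes n: "n > 0"
  shows "closedin (zariski d n)
    (commuting_nilpotent_tuples d n - one_regular_tuples d n :: 'a :: field mat list set)"
proof -
  have "closedin (zariski d n)
      {As \<in> mat_tuples d n. \<forall>c\<in>UNIV. lin_comb n c d As ^\<^sub>m (n - 1) = (0\<^sub>m n n :: 'a mat)}"
    by (intro closedin_regular_mat_eq regular_mat_on_pow regular_mat_on_lin_comb regular_mat_on_zero)
  from closedin_Int[OF closedin_commuting_nilpotent this]
  show ?thesis
    by (rule back_subst[of "closedin _"])
      (use one_regular_tuples_iff[OF _ n] commuting_nilpotentD(1) in blast)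
qed

section \<open>Rational curves and irreducibility\<close>

text \<open>A polynomial evaluated along a curve with common denominator \<open>D\<close> becomes a
  polynomial in \<open>t\<close> after multiplication by a power of \<open>D\<close>. The exponent
  grows with the construction of \<open>f\<close>.\<close>

lemma poly_funs_rational_curve:
  fixes w :: "'a :: field \<Rightarrow> 'a mat list"
  assumes curve: "\<And>t l i j. poly D t \<noteq> 0 \<Longrightarrow> l < d \<Longrightarrow> i < n \<Longrightarrow> j < n \<Longrightarrow>
      poly D t * (w t ! l) $$ (i, j) = poly (E l i j) t"
    and "f \<in> poly_funs d n"
  shows "\<exists>F m. \<forall>t. poly D t \<noteq> 0 \<longrightarrow> poly D t ^ m * f (w t) = poly F t"
  using assms(2)
proof induction
  case (const c)
  show ?case by (intro exI[of _ "[:c:]"] exI[of _ 0]) simp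
next
  case (entry l i j)
  then show ?case using curve by (intro exI[of _ "E l i j"] exI[of _ 1]) simp
next
  case (add p q)
  then obtain F k G m where
    "\<And>t. poly D t \<noteq> 0 \<Longrightarrow> poly D t ^ k * p (w t) = poly F t"
    "\<And>t. poly D t \<noteq> 0 \<Longrightarrow> poly D t ^ m * q (w t) = poly G t" by blast
  then show ?case
    \<comment> \<open>Adding the exponents gives a common denominator; each numerator is multiplied
      by the power of \<open>D\<close> belonging to the other summand.\<close>
    by (intro exI[of _ "D ^ m * F + D ^ k * G"] exI[of _ "k + m"])
      (simp add: power_add algebra_simps flip: mult.assoc)
next
  case (mult p q)
  then obtain F k G m where
    "\<And>t. poly D t \<noteq> 0 \<Longrightarrow> poly D t ^ k * p (w t) = poly F t"
    "\<And>t. poly D t \<noteq> 0 \<Longrightarrow> poly D t ^ m * q (w t) = poly G t" by blast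
  note FG = this[symmetric]
  show ?case
    by (intro exI[of _ "F * G"] exI[of _ "k + m"]) (simp add: FG power_add algebra_simps)
qed

text \<open>Interpolate linearly between the two conjugating matrices and the two families of Toeplitz
  coefficients, and invert the resulting matrix by its adjugate; the only denominator is then the
  determinant.\<close>

lemma toeplitz_tuples_curve:
  fixes As Bs :: "'a :: field mat list"
  assumes As: "As \<in> toeplitz_tuples d n" and Bs: "Bs \<in> toeplitz_tuples d n"
  obtains w D E where "w 0 = As" "w 1 = Bs" "poly D 0 \<noteq> 0" "poly D 1 \<noteq> 0"
    "\<And>t. poly D t \<noteq> 0 \<Longrightarrow> w t \<in> toeplitz_tuples d n"
    "\<And>t l i j. poly D t \<noteq> 0 \<Longrightarrow> l < d \<Longrightarrow> i < n \<Longrightarrow> j < n \<Longrightarrow>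
      poly D t * (w t ! l) $$ (i, j) = poly (E l i j) t"
proof -
  obtain P a where tupA: "As \<in> mat_tuples d n" and P: "P \<in> carrier_mat n n" "det P \<noteq> 0"
    and a: "\<And>l. l < d \<Longrightarrow> As ! l * P = P * toeplitz_mat n (a l)"
    using As unfolding toeplitz_tuples_def by blast
  obtain Q b where tupB: "Bs \<in> mat_tuples d n" and Q: "Q \<in> carrier_mat n n" "det Q \<noteq> 0"
    and b: "\<And>l. l < d \<Longrightarrow> Bs ! l * Q = Q * toeplitz_mat n (b l)"
    using Bs unfolding toeplitz_tuples_def by blast
  \<comment> \<open>The entries of \<open>R\<close> are linear polynomials in \<open>t\<close> with
    value \<open>P\<close> at \<open>0\<close> and \<open>Q\<close> at \<open>1\<close>;
    \<open>T\<close> interpolates the coefficients \<open>a\<close> and \<open>b\<close> in the same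
    way.\<close>
  define R where "R = mat n n (\<lambda>ij. [:P $$ ij, Q $$ ij - P $$ ij:])"
  define T where "T = (\<lambda>l. toeplitz_mat n (\<lambda>k. [:a l k, b l k - a l k:]))"
  define M where "M = (\<lambda>l. R * T l * adj_mat R)"
  define ev :: "'a \<Rightarrow> 'a poly mat \<Rightarrow> 'a mat" where "ev = (\<lambda>t. map_mat (\<lambda>p. poly p t))"
  define w where "w = (\<lambda>t. map (\<lambda>l. inverse (poly (det R) t) \<cdot>\<^sub>m ev t (M l)) [0..<d])"
  have R: "R \<in> carrier_mat n n" and T: "T l \<in> carrier_mat n n" and adj: "adj_mat R \<in> carrier_mat n n" for l
    using adj_mat(1)[of R n] by (simp_all add: R_def T_def)
  then have M: "M l \<in> carrier_mat n n" for l
    unfolding M_def by (metis mult_carrier_mat)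
  have evR: "ev t R \<in> carrier_mat n n" and evM: "ev t (M l) \<in> carrier_mat n n" for t l
    using R M by (simp_all add: ev_def)
  have det: "det (ev t R) = poly (det R) t" for t
    unfolding ev_def by (rule comm_ring_hom.hom_det[OF poly_hom.comm_ring_hom_axioms])
  have ends: "ev 0 R = P" "ev 1 R = Q"
    using P Q by (auto simp: ev_def R_def)
  have evT: "ev t (T l) = toeplitz_mat n (\<lambda>k. poly [:a l k, b l k - a l k:] t)" for t l
    unfolding ev_def T_def by (intro eq_matI) (auto simp: toeplitz_mat_def)
  \<comment> \<open>Since \<open>adj_mat R * R\<close> is \<open>det R\<close> times the identity,
    \<open>M l\<close> is \<open>det R\<close> times the conjugate of \<open>T l\<close> by
    \<open>R\<close>, and its entries are still polynomials.\<close>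
  have MR: "M l * R = det R \<cdot>\<^sub>m (R * T l)" for l
  proof -
    have "M l * R = R * T l * (adj_mat R * R)"
      unfolding M_def using R T adj by (intro assoc_mult_mat[of _ n n _ n _ n]) auto
    then show ?thesis
      using mult_carrier_mat[OF R T] right_mult_one_mat[OF mult_carrier_mat[OF R T]]
      by (simp add: adj_mat(3)[OF R] mult_smult_distrib[of _ n n _ n])
  qed
  have evMR: "ev t (M l) * ev t R = poly (det R) t \<cdot>\<^sub>m (ev t R * ev t (T l))" for t l
  proof -
    have "ev t (M l) * ev t R = ev t (det R \<cdot>\<^sub>m (R * T l))"
      unfolding ev_def MR[symmetric] by (rule semiring_hom.mat_hom_mult[OF poly_hom.semiring_hom_axioms M R, symmetric])
    also have "\<dots> = poly (det R) t \<cdot>\<^sub>m ev t (R * T l)"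
      unfolding ev_def by (intro eq_matI) auto
    also have "ev t (R * T l) = ev t R * ev t (T l)"
      unfolding ev_def by (rule semiring_hom.mat_hom_mult[OF poly_hom.semiring_hom_axioms R T])
    finally show ?thesis .
  qed
  have wR: "w t ! l * ev t R = ev t R * toeplitz_mat n (\<lambda>k. poly [:a l k, b l k - a l k:] t)"
    if "poly (det R) t \<noteq> 0" "l < d" for t l
  proof -
    have cancel: "inverse x \<cdot>\<^sub>m (x \<cdot>\<^sub>m X) = X" if "x \<noteq> 0" for x :: 'a and X
      using that by (intro eq_matI) auto
    show ?thesis
      using that evR[of t] evM[of t l]
      by (simp add: w_def mult_smult_assoc_mat[of _ n n _ n] evMR evT cancel)
  qed
  have tup: "w t \<in> mat_tuples d n" for t
    using evM by (auto simp: w_def mat_tuples_def)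
  \<comment> \<open>At \<open>t = 0\<close> both tuples intertwine the invertible \<open>P\<close>
    with the same Toeplitz matrices, so cancelling \<open>P\<close> identifies them. The end
    \<open>t = 1\<close> is treated alike with \<open>Q\<close>.\<close>
  have w0: "w 0 = As"
  proof (rule nth_equalityI)
    fix l assume "l < length (w 0)"
    then have l: "l < d" by (simp add: w_def)
    have "w 0 ! l * P = As ! l * P"
      using wR[of 0 l] l a[OF l] P(2) det[of 0] by (simp add: ends)
    then show "w 0 ! l = As ! l"
      by (rule mat_right_cancel[OF mat_tuples_nth[OF tup l] mat_tuples_nth[OF tupA l] P])
  qed (use tup[of 0] tupA in \<open>simp add: mat_tuples_def\<close>)
  have w1: "w 1 = Bs"
  proof (rule nth_equalityI)
    fix l assume "l < length (w 1)"
    then have l: "l < d" by (simp add: w_def)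
    have "w 1 ! l * Q = Bs ! l * Q"
      using wR[of 1 l] l b[OF l] Q(2) det[of 1] by (simp add: ends)
    then show "w 1 ! l = Bs ! l"
      by (rule mat_right_cancel[OF mat_tuples_nth[OF tup l] mat_tuples_nth[OF tupB l] Q])
  qed (use tup[of 1] tupB in \<open>simp add: mat_tuples_def\<close>)
  have mem: "w t \<in> toeplitz_tuples d n" if "poly (det R) t \<noteq> 0" for t
    unfolding toeplitz_tuples_def
    using tup wR that evR det
    by (intro CollectI conjI bexI[of _ "ev t R"] exI[of _ "\<lambda>l k. poly [:a l k, b l k - a l k:] t"]) auto
  have ent: "poly (det R) t * (w t ! l) $$ (i, j) = poly (M l $$ (i, j)) t"
    if "poly (det R) t \<noteq> 0" "l < d" "i < n" "j < n" for t l i j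
    using that M[of l] by (simp add: w_def ev_def)
  show thesis
    by (rule that[of w "det R" "\<lambda>l i j. M l $$ (i, j)"])
      (use w0 w1 mem ent det[of 0] det[of 1] ends P(2) Q(2) in simp_all)
qed

text \<open>Along a curve from \<open>As\<close> to \<open>Bs\<close>, \<open>f\<close> and
  \<open>g\<close> turn into polynomials \<open>F\<close> and \<open>G\<close> in \<open>t\<close>,
  nonzero because \<open>F\<close> does not vanish at \<open>0\<close> nor \<open>G\<close> at
  \<open>1\<close>. Over an infinite field some \<open>t\<close> is a root of none of
  \<open>D\<close>, \<open>F\<close>, \<open>G\<close>, and the curve at this \<open>t\<close> is
  the required tuple.\<close>

lemma toeplitz_tuples_no_split:
  fixes f g :: "'a :: field mat list \<Rightarrow> 'a"
  assumes inf: "infinite (UNIV :: 'a set)"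
    and f: "f \<in> poly_funs d n" and g: "g \<in> poly_funs d n"
    and As: "As \<in> toeplitz_tuples d n" "f As \<noteq> 0" and Bs: "Bs \<in> toeplitz_tuples d n" "g Bs \<noteq> 0"
  shows "\<exists>Cs \<in> toeplitz_tuples d n. f Cs \<noteq> 0 \<and> g Cs \<noteq> 0"
proof -
  obtain w D E where w: "w 0 = As" "w 1 = Bs" "poly D 0 \<noteq> 0" "poly D 1 \<noteq> 0"
    "\<And>t. poly D t \<noteq> 0 \<Longrightarrow> w t \<in> toeplitz_tuples d n"
    and curve: "\<And>t l i j. poly D t \<noteq> 0 \<Longrightarrow> l < d \<Longrightarrow> i < n \<Longrightarrow> j < n \<Longrightarrow>
      poly D t * (w t ! l) $$ (i, j) = poly (E l i j) t"
    using toeplitz_tuples_curve[OF As(1) Bs(1)] by blast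
  obtain F k where F: "\<And>t. poly D t \<noteq> 0 \<Longrightarrow> poly D t ^ k * f (w t) = poly F t"
    using poly_funs_rational_curve[of D d n w E f, OF curve f] by blast
  obtain G m where G: "\<And>t. poly D t \<noteq> 0 \<Longrightarrow> poly D t ^ m * g (w t) = poly G t"
    using poly_funs_rational_curve[of D d n w E g, OF curve g] by blast
  have "poly F 0 \<noteq> 0" "poly G 1 \<noteq> 0"
    using F[of 0] G[of 1] w As(2) Bs(2) by auto
  then have "D * F * G \<noteq> 0" using w(3) by auto
  then have "finite {t. poly (D * F * G) t = 0}" by (rule poly_roots_finite)
  then have "{t. poly (D * F * G) t = 0} \<noteq> UNIV" using inf by metis
  then obtain t where t: "poly (D * F * G) t \<noteq> 0" by blast
  then have "poly D t \<noteq> 0" "poly F t \<noteq> 0" "poly G t \<noteq> 0" by auto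
  with F[of t] G[of t] have "f (w t) \<noteq> 0" "g (w t) \<noteq> 0" by auto
  with w(5) \<open>poly D t \<noteq> 0\<close> show ?thesis by blast
qed

text \<open>By density a proper closed subset cannot contain all of \<open>toeplitz_tuples\<close>,
  so some polynomial vanishes on the subset but not on \<open>toeplitz_tuples\<close>. If two such
  subsets covered the variety, \<open>toeplitz_tuples_no_split\<close> would give a point outside
  both.\<close>

lemma irreducible_commuting_nilpotent:
  assumes inf: "infinite (UNIV :: 'a :: field set)"
    and dense: "(zariski d n closure_of toeplitz_tuples d n)
      = (commuting_nilpotent_tuples d n :: 'a mat list set)"
    and ne: "commuting_nilpotent_tuples d n \<noteq> ({} :: 'a mat list set)"
  shows "irreducible_space
    (subtopology (zariski d n) (commuting_nilpotent_tuples d n :: 'a mat list set))"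
proof -
  let ?N = "commuting_nilpotent_tuples d n :: 'a mat list set"
  have top: "topspace (subtopology (zariski d n) ?N) = ?N"
    using commuting_nilpotentD(1) by (auto simp: topspace_zariski)
  have witness: "\<exists>f As. f \<in> poly_funs d n \<and> As \<in> toeplitz_tuples d n \<and> f As \<noteq> 0 \<and> (\<forall>Cs\<in>S. f Cs = 0)"
    if S: "closedin (subtopology (zariski d n) ?N) S" "S \<noteq> ?N" for S
  proof -
    obtain C where C: "closedin (zariski d n) C" "S = C \<inter> ?N"
      using S(1) unfolding closedin_subtopology by blast
    obtain F where F: "F \<subseteq> poly_funs d n" "C = zero_locus d n F"
      using C(1) unfolding closedin_zariski by blast
    have "\<not> toeplitz_tuples d n \<subseteq> C"
      using closure_of_minimal[OF _ C(1)] dense C(2) S(2) by blast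
    then obtain As where "As \<in> toeplitz_tuples d n" "As \<notin> C" by blast
    then obtain f where "f \<in> F" "f As \<noteq> 0"
      unfolding F(2) zero_locus_def toeplitz_tuples_def by blast
    moreover have "\<forall>Cs\<in>S. f Cs = 0" using \<open>f \<in> F\<close> unfolding C(2) F(2) zero_locus_def by blast
    ultimately show ?thesis using F(1) \<open>As \<in> toeplitz_tuples d n\<close> by blast
  qed
  show ?thesis unfolding irreducible_space_def top
  proof (intro conjI allI impI)
    fix S T assume S: "closedin (subtopology (zariski d n) ?N) S"
      and T: "closedin (subtopology (zariski d n) ?N) T" and un: "S \<union> T = ?N"
    show "S = ?N \<or> T = ?N"
    proof (rule ccontr)
      assume "\<not> (S = ?N \<or> T = ?N)"
      then obtain f As g Bs where "f \<in> poly_funs d n" "As \<in> toeplitz_tuples d n" "f As \<noteq> 0"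
        "g \<in> poly_funs d n" "Bs \<in> toeplitz_tuples d n" "g Bs \<noteq> 0"
        and van: "\<forall>Cs\<in>S. f Cs = 0" "\<forall>Cs\<in>T. g Cs = 0"
        using witness[OF S] witness[OF T] by blast
      then obtain Cs where "Cs \<in> toeplitz_tuples d n" "f Cs \<noteq> 0" "g Cs \<noteq> 0"
        using toeplitz_tuples_no_split[OF inf] by blast
      then show False using van un toeplitz_tuples_subset[of d n] by blast
    qed
  qed (rule ne)
qed

lemma one_regular_tuples_nonempty:
  assumes "d > 0" "n > 0"
  shows "one_regular_tuples d n \<noteq> ({} :: 'a :: field mat list set)"
proof -
  let ?J = "jordan_block n (0 :: 'a)" and ?As = "replicate d (jordan_block n (0 :: 'a))"
  \<comment> \<open>The top right corner is the entry that shows that the power \<open>n - 1\<close>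
    of the block is nonzero.\<close>
  have pow: "(?J ^\<^sub>m k) $$ (0, n - 1) = (if k = n - 1 then 1 else 0)" if "n - 1 \<le> k" for k
    using assms(2) that unfolding jordan_block_pow by (auto simp: power_0_left binomial_eq_0)
  have "?J ^\<^sub>m n = 0\<^sub>m n n"
    unfolding jordan_block_pow by (intro eq_matI) auto
  then have "nilpotent_mat ?J" by (auto simp: nilpotent_mat_def)
  then have As: "?As \<in> commuting_nilpotent_tuples d n"
    by (intro commuting_nilpotentI) (auto simp: mat_tuples_def)
  \<comment> \<open>The coefficients pick out the first of the \<open>d\<close> copies, which exists
    because \<open>d > 0\<close>.\<close>
  have "lin_comb n (\<lambda>l. if l = 0 then 1 else 0) d ?As = ?J"
    using assms(1) by (intro eq_matI)
      (auto simp: lin_comb_def if_distrib[of "\<lambda>x. x * _"] cong: if_cong)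
  moreover have "?J ^\<^sub>m (n - 1) \<noteq> 0\<^sub>m n n"
    using pow[of "n - 1"] assms(2) by auto
  ultimately have "?As \<in> one_regular_tuples d n"
    using one_regular_tuples_iff[OF As assms(2)] by metis
  then show ?thesis by blast
qed

theorem corollary2:
  fixes d n :: nat
  assumes "d > 0" and "n > 0"
  shows "irreducible_space
           (subtopology (zariski d n)
             (commuting_nilpotent_tuples d n :: 'a :: alg_closed_field mat list set))
         \<longleftrightarrow> zariski d n closure_of one_regular_tuples d n
               = (commuting_nilpotent_tuples d n :: 'a mat list set)"
proof -
  let ?N = "commuting_nilpotent_tuples d n :: 'a mat list set"
  let ?R = "one_regular_tuples d n :: 'a mat list set"
  have RN: "?R \<subseteq> ?N" by (auto simp: one_regular_tuples_def)
  have N: "?N \<subseteq> topspace (zariski d n)"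
    using commuting_nilpotentD(1) by (auto simp: topspace_zariski)
  have ne: "?R \<noteq> {}" by (rule one_regular_tuples_nonempty[OF assms])
  show ?thesis
  proof
    let ?X = "subtopology (zariski d n) ?N"
    assume irr: "irreducible_space ?X"
    have top: "topspace ?X = ?N" using N by auto
    \<comment> \<open>The variety is covered by two closed sets: the trace of the closure of
      \<open>?R\<close>, and the complement of \<open>?R\<close>.\<close>
    have "closedin ?X ((zariski d n closure_of ?R) \<inter> ?N)"
      unfolding closedin_subtopology 
      by (intro exI[of _ "zariski d n closure_of ?R"] conjI closedin_closure_of refl)
    moreover have "closedin ?X (?N - ?R)"
      unfolding closedin_subtopology
      by (intro exI[of _ "?N - ?R"] conjI closedin_not_one_regular[OF assms(2)]) blast
    moreover have "(zariski d n closure_of ?R) \<inter> ?N \<union> (?N - ?R) = ?N"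
      using closure_of_subset[of ?R "zariski d n"] RN N by blast
    ultimately have "(zariski d n closure_of ?R) \<inter> ?N = ?N \<or> ?N - ?R = ?N"
      using irr unfolding irreducible_space_def top by blast
    \<comment> \<open>The second alternative, \<open>?N - ?R = ?N\<close>, would force
      \<open>?R\<close> to be empty.\<close>
    then have "?N \<subseteq> (zariski d n closure_of ?R)" using RN ne by blast
    moreover have "(zariski d n closure_of ?R) \<subseteq> ?N"
      by (rule closure_of_minimal[OF RN closedin_commuting_nilpotent])
    ultimately show "(zariski d n closure_of ?R) = ?N" by blast
  next
    assume dense: "(zariski d n closure_of ?R) = ?N"
    \<comment> \<open>The Toeplitz tuples lie between \<open>?R\<close> and the closed set
      \<open>?N\<close>, so density of \<open>?R\<close> passes on to them.\<close>
    have "(zariski d n closure_of toeplitz_tuples d n) \<subseteq> ?N"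
      by (rule closure_of_minimal[OF toeplitz_tuples_subset closedin_commuting_nilpotent])
    moreover have "?N \<subseteq> (zariski d n closure_of toeplitz_tuples d n)"
      unfolding dense[symmetric] by (rule closure_of_mono[OF one_regular_tuples_subset_toeplitz[OF assms(2)]])
    ultimately show "irreducible_space (subtopology (zariski d n) ?N)"
      using irreducible_commuting_nilpotent[OF infinite_UNIV_alg_closed] RN ne by blast
  qed
qed

end
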